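(* Assume $q$ is not a root of unity. Let $M$ be a highest weight module over $U$ with highest weight $\lambda=(\lambda_1,\lambda_2)\in(k^{\times})^2$. If $M$ is simple, then (1) $M\simeq L(\lambda)$ if $M$ is finite dimensional (in particular $\lambda$ is then such that $L(\lambda)$ is defined); (2) $M\simeq V(\lambda)$ if $M$ is infinite dimensional.
   Context: $k$ is an algebraically closed field of characteristic $0$, $q\in k\setminus\{0,\pm1\}$, and $a_{11}=a_{22}=2$, $a_{12}=a_{21}=-1$. $U$ is the unital $k$-algebra generated by $E_i,F_i,K_i,K_i^{-1}$ ($i=1,2$) with relations (for $i,j\in\{1,2\}$): $K_iK_j=K_jK_i$; $K_iK_i^{-1}=K_i^{-1}K_i=1$; $K_iE_jK_i^{-1}=q^{a_{ji}}E_j$; $K_iF_jK_i^{-1}=q^{-a_{ji}}F_j$; $E_1F_1-F_1E_1=(K_1-K_1^{-1})/(q-q^{-1})$; $E_iF_j-F_jE_i=0$ for $(i,j)\neq(1,1)$ (in particular $E_2F_2=F_2E_2$); and for $i\neq j$, $E_i^2E_j-(q+q^{-1})E_iE_jE_i+E_jE_i^2=0$ and $F_i^2F_j-(q+q^{-1})F_iF_jF_i+F_jF_i^2=0$. For a $U$-module $M$ and $\lambda=(\lambda_1,\lambda_2)\in(k^\times)^2$, a weight vector of weight $\lambda$ is a nonzero $v\in M$ with $K_iv=\lambda_iv$ ($i=1,2$); it is a highest weight vector if moreover $E_1v=E_2v=0$. $M$ is a highest weight module with highest weight $\lambda$ if it is generated by a highest weight vector of weight $\lambda$. Write $[n]_q=(q^n-q^{-n})/(q-q^{-1})$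 and $[a;n]_q=(aq^n-a^{-1}q^{-n})/(q-q^{-1})$. For $\lambda\in(k^\times)^2$, $V(\lambda)$ is the $U$-module with basis $u_0,u_1,u_2,\dots$ and action $K_1u_j=\lambda_1q^{-2j}u_j$, $K_2u_j=\lambda_2q^{j}u_j$, $F_1u_j=u_{j+1}$, $E_1u_j=[j]_q[\lambda_1;1-j]_qu_{j-1}$, $E_2u_j=F_2u_j=0$ (with $u_{-1}=0$). If $\lambda_1=\pm q^{m_1}$ for some integer $m_1\geq 0$, then $J'(\lambda)=\mathrm{span}\{u_{m_1+1},u_{m_1+2},\dots\}$ is the unique maximal submodule of $V(\lambda)$, and $L(\lambda):=V(\lambda)/J'(\lambda)$, a simple module of dimension $m_1+1$. $L(\lambda)$ is defined only for such $\lambda$. *)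

theory Defs
  imports "HOL-Algebra.Algebraic_Closure_Type" "HOL-Library.Poly_Mapping"
begin

section \<open>Left modules over a not necessarily commutative ring\<close>

text \<open>
  The locale \<^locale>\<open>module\<close> of the library requires a commutative ring of scalars; the record type
  and the notion \<^locale>\<open>submodule\<close> do not. The fields mult and one of a module record play
  no role.
\<close>

locale left_module = R?: ring R + M?: abelian_group M
  for R :: "('a, 'b) ring_scheme" and M :: "('a, 'c, 'd) module_scheme" (structure) +
  assumes smult_closed:
      "\<lbrakk>a \<in> carrier R; x \<in> carrier M\<rbrakk> \<Longrightarrow> a \<odot>\<^bsub>M\<^esub> x \<in> carrier M"
    and smult_l_distr:
      "\<lbrakk>a \<in> carrier R; b \<in> carrier R; x \<in> carrier M\<rbrakk> \<Longrightarrow>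
        (a \<oplus>\<^bsub>R\<^esub> b) \<odot>\<^bsub>M\<^esub> x = a \<odot>\<^bsub>M\<^esub> x \<oplus>\<^bsub>M\<^esub> b \<odot>\<^bsub>M\<^esub> x"
    and smult_r_distr:
      "\<lbrakk>a \<in> carrier R; x \<in> carrier M; y \<in> carrier M\<rbrakk> \<Longrightarrow>
        a \<odot>\<^bsub>M\<^esub> (x \<oplus>\<^bsub>M\<^esub> y) = a \<odot>\<^bsub>M\<^esub> x \<oplus>\<^bsub>M\<^esub> a \<odot>\<^bsub>M\<^esub> y"
    and smult_assoc:
      "\<lbrakk>a \<in> carrier R; b \<in> carrier R; x \<in> carrier M\<rbrakk> \<Longrightarrow>
        (a \<otimes>\<^bsub>R\<^esub> b) \<odot>\<^bsub>M\<^esub> x = a \<odot>\<^bsub>M\<^esub> (b \<odot>\<^bsub>M\<^esub> x)"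
    and smult_one:
      "x \<in> carrier M \<Longrightarrow> \<one>\<^bsub>R\<^esub> \<odot>\<^bsub>M\<^esub> x = x"

definition generated_submodule ::
  "('a, 'b) ring_scheme \<Rightarrow> ('a, 'c, 'd) module_scheme \<Rightarrow> 'c set \<Rightarrow> 'c set" where
  "generated_submodule R M S = \<Inter>{N. submodule N R M \<and> S \<subseteq> N}"

definition simple_module :: "('a, 'b) ring_scheme \<Rightarrow> ('a, 'c, 'd) module_scheme \<Rightarrow> bool" where
  "simple_module R M \<longleftrightarrow>
     left_module R M \<and> carrier M \<noteq> {\<zero>\<^bsub>M\<^esub>} \<and>
     (\<forall>N. submodule N R M \<longrightarrow> N = {\<zero>\<^bsub>M\<^esub>} \<or> N = carrier M)"

definition module_iso ::
  "('a, 'b) ring_scheme \<Rightarrow> ('a, 'c, 'd) module_scheme \<Rightarrow> ('a, 'e, 'f) module_scheme \<Rightarrow> ('c \<Rightarrow> 'e) set"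
  where
  "module_iso R M N =
     {f \<in> iso (add_monoid M) (add_monoid N).
        \<forall>a\<in>carrier R. \<forall>x\<in>carrier M. f (a \<odot>\<^bsub>M\<^esub> x) = a \<odot>\<^bsub>N\<^esub> f x}"

definition modules_isomorphic ::
  "('a, 'b) ring_scheme \<Rightarrow> ('a, 'c, 'd) module_scheme \<Rightarrow> ('a, 'e, 'f) module_scheme \<Rightarrow> bool" where
  "modules_isomorphic R M N \<longleftrightarrow> module_iso R M N \<noteq> {}"

text \<open>
  The quotient of a module by a submodule: the additive cosets, with the action of a scalar on a
  coset written as a union over representatives, as the multiplication of \<^const>\<open>FactRing\<close> is.
\<close>

definition quotient_module :: "('a, 'c, 'd) module_scheme \<Rightarrow> 'c set \<Rightarrow> ('a, 'c set) module" where
  "quotient_module M H =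
     \<lparr>carrier = a_rcosets\<^bsub>M\<^esub> H, monoid.mult = undefined, one = undefined,
      zero = H, add = set_add M,
      module.smult = (\<lambda>a A. \<Union>x\<in>A. H +>\<^bsub>M\<^esub> (a \<odot>\<^bsub>M\<^esub> x))\<rparr>"


section \<open>The algebra \<open>U\<close>\<close>

datatype idx = I1 | I2

datatype gen = GE idx | GF idx | GK idx | GKinv idx

text \<open>
  With concatenation as addition, lists are the free monoid, and the convolution product of
  \<^theory>\<open>HOL-Library.Poly_Mapping\<close> turns the finitely supported functions on words into
  the free unital algebra.
\<close>

instantiation list :: (type) monoid_add
begin
definition zero_list :: "'a list" where "zero_list = []"
definition plus_list :: "'a list \<Rightarrow> 'a list \<Rightarrow> 'a list" where "plus_list = append"
instance by standard (simp_all add: zero_list_def plus_list_def)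
end

type_synonym 'k falg = "gen list \<Rightarrow>\<^sub>0 'k"

abbreviation free_alg :: "('k::field) falg ring" where
  "free_alg \<equiv> ring_of_type_algebra"

definition scal :: "'k::field \<Rightarrow> 'k falg" where "scal c = Poly_Mapping.single [] c"

definition gen_elt :: "gen \<Rightarrow> ('k::field) falg" where "gen_elt g = Poly_Mapping.single [g] 1"

abbreviation EE :: "idx \<Rightarrow> ('k::field) falg" where "EE i \<equiv> gen_elt (GE i)"
abbreviation FF :: "idx \<Rightarrow> ('k::field) falg" where "FF i \<equiv> gen_elt (GF i)"
abbreviation KK :: "idx \<Rightarrow> ('k::field) falg" where "KK i \<equiv> gen_elt (GK i)"
abbreviation KI :: "idx \<Rightarrow> ('k::field) falg" where "KI i \<equiv> gen_elt (GKinv i)"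

definition cartan :: "idx \<Rightarrow> idx \<Rightarrow> int" where
  "cartan i j = (if i = j then 2 else -1)"

text \<open>A relation \<open>x = y\<close> is represented by the element \<open>x - y\<close> of the free algebra.\<close>

definition U_relations :: "'k::field \<Rightarrow> 'k falg set" where
  "U_relations q =
     {KK i * KK j - KK j * KK i | i j. True}
   \<union> {KK i * KI i - 1 | i. True} \<union> {KI i * KK i - 1 | i. True}
   \<union> {KK i * EE j * KI i - scal (q powi cartan j i) * EE j | i j. True}
   \<union> {KK i * FF j * KI i - scal (q powi (- cartan j i)) * FF j | i j. True}
   \<union> {EE I1 * FF I1 - FF I1 * EE I1 - scal (1 / (q - inverse q)) * (KK I1 - KI I1)}
   \<union> {EE i * FF j - FF j * EE i | i j. (i, j) \<noteq> (I1, I1)}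
   \<union> {EE i * EE i * EE j - scal (q + inverse q) * EE i * EE j * EE i + EE j * EE i * EE i
        | i j. i \<noteq> j}
   \<union> {FF i * FF i * FF j - scal (q + inverse q) * FF i * FF j * FF i + FF j * FF i * FF i
        | i j. i \<noteq> j}"

definition U_ideal :: "'k::field \<Rightarrow> 'k falg set" where
  "U_ideal q = genideal free_alg (U_relations q)"

definition U :: "'k::field \<Rightarrow> 'k falg set ring" where
  "U q = free_alg Quot (U_ideal q)"

text \<open>The class in \<open>U\<close> of an element of the free algebra.\<close>

definition cls :: "'k::field \<Rightarrow> 'k falg \<Rightarrow> 'k falg set" where
  "cls q p = U_ideal q +>\<^bsub>free_alg\<^esub> p"


section \<open>Highest weight modules\<close>

text \<open>Every \<open>U\<close>-module is a vector space over the ground field through \<open>c \<mapsto> cls q (scal c)\<close>.\<close>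

definition finite_dim :: "'k::field \<Rightarrow> ('k falg set, 'm) module \<Rightarrow> bool" where
  "finite_dim q M \<longleftrightarrow>
     (\<exists>B. finite B \<and> B \<subseteq> carrier M \<and>
        (\<forall>x\<in>carrier M. \<exists>c. x = (\<Oplus>\<^bsub>M\<^esub>b\<in>B. cls q (scal (c b)) \<odot>\<^bsub>M\<^esub> b)))"

definition weight_vector ::
  "'k::field \<Rightarrow> ('k falg set, 'm) module \<Rightarrow> (idx \<Rightarrow> 'k) \<Rightarrow> 'm \<Rightarrow> bool" where
  "weight_vector q M lam v \<longleftrightarrow>
     v \<in> carrier M \<and> v \<noteq> \<zero>\<^bsub>M\<^esub> \<and>
     (\<forall>i. cls q (KK i) \<odot>\<^bsub>M\<^esub> v = cls q (scal (lam i)) \<odot>\<^bsub>M\<^esub> v)"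

definition highest_weight_vector ::
  "'k::field \<Rightarrow> ('k falg set, 'm) module \<Rightarrow> (idx \<Rightarrow> 'k) \<Rightarrow> 'm \<Rightarrow> bool" where
  "highest_weight_vector q M lam v \<longleftrightarrow>
     weight_vector q M lam v \<and> (\<forall>i. cls q (EE i) \<odot>\<^bsub>M\<^esub> v = \<zero>\<^bsub>M\<^esub>)"

definition highest_weight_module ::
  "'k::field \<Rightarrow> ('k falg set, 'm) module \<Rightarrow> (idx \<Rightarrow> 'k) \<Rightarrow> bool" where
  "highest_weight_module q M lam \<longleftrightarrow>
     left_module (U q) M \<and>
     (\<exists>v. highest_weight_vector q M lam v \<and> generated_submodule (U q) M {v} = carrier M)"


section \<open>The modules \<open>V(\<lambda>)\<close> and \<open>L(\<lambda>)\<close>\<close>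

definition qint :: "'k::field \<Rightarrow> int \<Rightarrow> 'k" where
  "qint q n = (q powi n - q powi (- n)) / (q - inverse q)"

definition qbracket :: "'k::field \<Rightarrow> 'k \<Rightarrow> int \<Rightarrow> 'k" where
  "qbracket q a n = (a * q powi n - inverse a * q powi (- n)) / (q - inverse q)"

text \<open>
  The underlying space of \<open>V(\<lambda>)\<close> is the type of finitely supported functions on the naturals, with
  basis vectors \<open>u\<^sub>j = Poly_Mapping.single j 1\<close>; \<open>V_basis q \<lambda> g j\<close> is \<open>g \<cdot> u\<^sub>j\<close> for a generator \<open>g\<close>.
\<close>

fun V_basis :: "'k::field \<Rightarrow> (idx \<Rightarrow> 'k) \<Rightarrow> gen \<Rightarrow> nat \<Rightarrow> (nat \<Rightarrow>\<^sub>0 'k)" where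
  "V_basis q lam (GK I1) j = Poly_Mapping.single j (lam I1 * q powi (- 2 * int j))"
| "V_basis q lam (GK I2) j = Poly_Mapping.single j (lam I2 * q powi int j)"
| "V_basis q lam (GKinv I1) j = Poly_Mapping.single j (inverse (lam I1 * q powi (- 2 * int j)))"
| "V_basis q lam (GKinv I2) j = Poly_Mapping.single j (inverse (lam I2 * q powi int j))"
| "V_basis q lam (GF I1) j = Poly_Mapping.single (Suc j) 1"
| "V_basis q lam (GE I1) j =
     (if j = 0 then 0
      else Poly_Mapping.single (j - 1) (qint q (int j) * qbracket q (lam I1) (1 - int j)))"
| "V_basis q lam (GE I2) j = 0"
| "V_basis q lam (GF I2) j = 0"

definition V_gen :: "'k::field \<Rightarrow> (idx \<Rightarrow> 'k) \<Rightarrow> gen \<Rightarrow> (nat \<Rightarrow>\<^sub>0 'k) \<Rightarrow> (nat \<Rightarrow>\<^sub>0 'k)" where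
  "V_gen q lam g x =
     (\<Sum>j\<in>Poly_Mapping.keys x. Poly_Mapping.map ((*) (Poly_Mapping.lookup x j)) (V_basis q lam g j))"

definition V_free :: "'k::field \<Rightarrow> (idx \<Rightarrow> 'k) \<Rightarrow> 'k falg \<Rightarrow> (nat \<Rightarrow>\<^sub>0 'k) \<Rightarrow> (nat \<Rightarrow>\<^sub>0 'k)" where
  "V_free q lam p x =
     (\<Sum>w\<in>Poly_Mapping.keys p.
        Poly_Mapping.map ((*) (Poly_Mapping.lookup p w)) (foldr (V_gen q lam) w x))"

text \<open>
  For \<open>q \<notin> {0, 1, -1}\<close> and nonzero \<open>\<lambda>\<^sub>1, \<lambda>\<^sub>2\<close> the defining relations of \<open>U\<close> act as zero, so all
  representatives of a class in \<open>U\<close> act in the same way and \<^const>\<open>the_elem\<close> picks that common action.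
\<close>

definition V :: "'k::field \<Rightarrow> (idx \<Rightarrow> 'k) \<Rightarrow> ('k falg set, nat \<Rightarrow>\<^sub>0 'k) module" where
  "V q lam =
     \<lparr>carrier = UNIV, monoid.mult = undefined, one = undefined, zero = 0, add = (+),
      module.smult = (\<lambda>a x. the_elem ((\<lambda>p. V_free q lam p x) ` a))\<rparr>"

text \<open>The span of \<open>u\<^sub>j\<close> for \<open>j > m\<close>.\<close>

definition J' :: "nat \<Rightarrow> (nat \<Rightarrow>\<^sub>0 'k::field) set" where
  "J' m = {x. Poly_Mapping.keys x \<subseteq> {m<..}}"

text \<open>
  \<open>m\<close> stands for the exponent \<open>m\<^sub>1\<close> with \<open>\<lambda>\<^sub>1 = \<plusminus>q\<^bsup>m\<^sub>1\<^esup>\<close>, which is determined by \<open>\<lambda>\<close>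
  when \<open>q\<close> is not a root of unity; \<open>L q \<lambda> m\<close> is \<open>L(\<lambda>)\<close> only under \<open>L_defined q \<lambda> m\<close>.
\<close>

definition L_defined :: "'k::field \<Rightarrow> (idx \<Rightarrow> 'k) \<Rightarrow> nat \<Rightarrow> bool" where
  "L_defined q lam m \<longleftrightarrow> lam I1 = q ^ m \<or> lam I1 = - (q ^ m)"

definition L :: "'k::field \<Rightarrow> (idx \<Rightarrow> 'k) \<Rightarrow> nat \<Rightarrow> ('k falg set, (nat \<Rightarrow>\<^sub>0 'k) set) module" where
  "L q lam m = quotient_module (V q lam) (J' m)"

end

theory Submission
  imports Defs
begin

text \<open>
  The module \<open>M\<close> is compared with \<open>V(\<lambda>)\<close> through the orbit \<open>w\<^sub>j = F\<^sub>1\<^bsup>j\<^esup>v\<close> of a highest weight vector \<open>v\<close>. The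
  pair \<open>E\<^sub>1, F\<^sub>1\<close> behaves as in quantum \<open>sl\<^sub>2\<close>, so the formulas for \<open>K\<^sub>i\<close>, \<open>E\<^sub>1\<close> and \<open>F\<^sub>1\<close> on the \<open>w\<^sub>j\<close> are those on
  the basis \<open>u\<^sub>j\<close> of \<open>V(\<lambda>)\<close>. In addition \<open>E\<^sub>2w\<^sub>j = 0\<close>, because \<open>E\<^sub>2\<close> commutes with \<open>F\<^sub>1\<close>.

  The key step is \<open>F\<^sub>2w\<^sub>j = 0\<close> (lemma \<open>F2_w_eq_zero\<close>). In \<open>U\<close>, unlike in the quantum group of
  \<open>sl\<^sub>3\<close>, \<open>F\<^sub>2\<close> commutes with \<open>E\<^sub>1\<close> and with \<open>E\<^sub>2\<close>. Therefore the vectors obtained from \<open>v\<close> by words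
  containing \<open>F\<^sub>2\<close> at least once span a submodule, and it does not contain \<open>v\<close>: the element \<open>K\<^sub>1K\<^sub>2\<^sup>2\<close>, which
  commutes with \<open>F\<^sub>1\<close> and passes \<open>F\<^sub>2\<close> with the factor \<open>q\<^sup>-\<^sup>3\<close>, has different eigenvalues on it, as \<open>q\<close> is not a
  root of unity. By simplicity that submodule is zero.

  Hence \<open>u\<^sub>j \<mapsto> w\<^sub>j\<close> defines a module homomorphism \<open>psi\<close> from \<open>V(\<lambda>)\<close> onto \<open>M\<close>, again by simplicity (lemmas \<open>psi_V_free\<close> and
  \<open>range_psi\<close>). Its kernel is graded, because \<open>K\<^sub>1\<close> separates the \<open>u\<^sub>j\<close> (lemma \<open>psi_kernel\<close>), so it is spanned by
  the \<open>u\<^sub>j\<close> with \<open>w\<^sub>j = 0\<close>. Either no \<open>w\<^sub>j\<close> vanishes; then \<open>psi\<close> is an isomorphism and \<open>M\<close> is infinite dimensional. Or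
  there is a last nonzero \<open>w\<^sub>m\<close>; then applying \<open>E\<^sub>1\<close> to \<open>w\<^bsub>m+1\<^esub> = 0\<close> gives \<open>\<lambda>\<^sub>1 = \<plusminus>q\<^bsup>m\<^esup>\<close>, the kernel is \<open>J'(\<lambda>)\<close>, and
  \<open>M\<close> is finite dimensional and isomorphic to \<open>L(\<lambda>)\<close> (lemma \<open>w_dichotomy\<close>).
\<close>

section \<open>Classes of the free algebra in \<open>U\<close>\<close>

lemma free_alg_simps [simp]:
  "carrier (free_alg :: 'k::field falg ring) = UNIV"
  "p \<otimes>\<^bsub>(free_alg :: 'k falg ring)\<^esub> r = p * r"
  "p \<oplus>\<^bsub>(free_alg :: 'k falg ring)\<^esub> r = p + r"
  "\<one>\<^bsub>(free_alg :: 'k falg ring)\<^esub> = 1"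
  "\<zero>\<^bsub>(free_alg :: 'k falg ring)\<^esub> = 0"
  by (simp_all add: ring_of_type_algebra_def)

lemma ring_free_alg: "ring (free_alg :: 'k::field falg ring)"
proof -
  have "\<exists>y. x + y = 0" for x :: "'k falg"
    by (rule exI[of _ "- x"]) simp
  moreover have "\<exists>y. y + x = 0 \<and> x + y = 0" for x :: "'k falg"
    by (rule exI[of _ "- x"]) simp
  ultimately show ?thesis
    unfolding ring_of_type_algebra_def
    by unfold_locales (auto simp: algebra_simps Units_def)
qed

lemma a_inv_free_alg: "\<ominus>\<^bsub>(free_alg :: 'k::field falg ring)\<^esub> r = - r"
proof -
  interpret ring "free_alg :: 'k falg ring" by (rule ring_free_alg)
  show ?thesis using minus_equality[of "- r" r] by simp
qed

lemma minus_free_alg [simp]: "a_minus (free_alg :: 'k::field falg ring) p r = p - r"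
  by (simp add: a_minus_def a_inv_free_alg)

lemma ideal_U_ideal: "ideal (U_ideal q) free_alg"
  unfolding U_ideal_def by (rule ring.genideal_ideal[OF ring_free_alg]) simp

lemma U_relations_subset: "U_relations q \<subseteq> U_ideal q"
  unfolding U_ideal_def by (rule ring.genideal_self[OF ring_free_alg]) simp

lemma carrier_U: "carrier (U q) = range (cls q)"
  by (auto simp: U_def FactRing_def A_RCOSETS_defs cls_def a_r_coset_def)

lemma cls_mem [simp]: "cls q p \<in> carrier (U q)"
  by (simp add: carrier_U)

lemma cls_add [simp]: "cls q p \<oplus>\<^bsub>U q\<^esub> cls q r = cls q (p + r)"
proof -
  interpret ideal "U_ideal q" free_alg by (rule ideal_U_ideal)
  show ?thesis
    using a_rcos_sum[of p r] by (simp add: U_def FactRing_def cls_def)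
qed

lemma cls_mult [simp]: "cls q p \<otimes>\<^bsub>U q\<^esub> cls q r = cls q (p * r)"
  using ideal.rcoset_mult_add[OF ideal_U_ideal, of p r q]
  by (simp add: U_def FactRing_def cls_def)

lemma cls_one [simp]: "\<one>\<^bsub>U q\<^esub> = cls q 1"
  by (simp add: U_def FactRing_def cls_def)

lemma mem_cls_iff: "r \<in> cls q p \<longleftrightarrow> r - p \<in> U_ideal q"
proof -
  interpret ideal "U_ideal q" free_alg by (rule ideal_U_ideal)
  show ?thesis
    using a_rcos_module_minus[OF ring_free_alg, of p r] by (simp add: cls_def)
qed

lemma cls_eqI: "p - r \<in> U_ideal q \<Longrightarrow> cls q p = cls q r"
proof -
  assume "p - r \<in> U_ideal q"
  then have "p \<in> cls q r" by (simp add: mem_cls_iff)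
  interpret ideal "U_ideal q" free_alg by (rule ideal_U_ideal)
  from a_repr_independence'[of p r] \<open>p \<in> cls q r\<close> show ?thesis
    by (simp add: cls_def)
qed

section \<open>Linear extension of maps given on a basis\<close>

definition scale :: "'k::field \<Rightarrow> ('a \<Rightarrow>\<^sub>0 'k) \<Rightarrow> ('a \<Rightarrow>\<^sub>0 'k)" where
  "scale c = Poly_Mapping.map ((*) c)"

lemma lookup_scale [simp]: "Poly_Mapping.lookup (scale c x) k = c * Poly_Mapping.lookup x k"
  by (simp add: scale_def map.rep_eq when_def)

lemma scale_simps [simp]:
  "scale c 0 = 0" "scale 0 x = 0" "scale 1 x = x"
  "scale c (scale d x) = scale (c * d) x"
  "scale c (Poly_Mapping.single k d) = Poly_Mapping.single k (c * d)"
  by (auto intro!: poly_mapping_eqI simp: lookup_single when_def)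

lemma scale_add: "scale c (x + y) = scale c x + scale c y" "scale (c + d) x = scale c x + scale d x"
  by (auto intro!: poly_mapping_eqI simp: lookup_add algebra_simps)

lemma scale_minus: "scale c (x - y) = scale c x - scale c y"
  by (auto intro!: poly_mapping_eqI simp: lookup_minus right_diff_distrib)

lemma scale_sum: "scale c (sum f S) = (\<Sum>s\<in>S. scale c (f s))"
  by (induction S rule: infinite_finite_induct) (simp_all add: scale_add)

lemma sum_single: "(\<Sum>k\<in>Poly_Mapping.keys x. Poly_Mapping.single k (Poly_Mapping.lookup x k)) = x"
  by (intro poly_mapping_eqI)
     (simp add: lookup_sum lookup_single when_def in_keys_iff)

lemma poly_mapping_induct_single [case_names single add]:
  fixes x :: "'a \<Rightarrow>\<^sub>0 'b::comm_monoid_add"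
  assumes "\<And>k c. P (Poly_Mapping.single k c)"
    and "\<And>x y. P x \<Longrightarrow> P y \<Longrightarrow> P (x + y)"
  shows "P x"
proof -
  have "P (\<Sum>k\<in>S. Poly_Mapping.single k (Poly_Mapping.lookup x k))" if "finite S" for S
    using that
  proof (induction S)
    case empty
    show ?case using assms(1)[of undefined 0] by simp
  qed (simp add: assms)
  from this[of "Poly_Mapping.keys x"] show ?thesis by (simp add: sum_single)
qed

text \<open>
  Unlike in the induction over all single terms, the last case is confined to the terms that actually
  occur in \<open>x\<close>, so that properties of the support of \<open>x\<close> can be used.
\<close>

lemma poly_mapping_keys_induct:
  fixes x :: "'a \<Rightarrow>\<^sub>0 'c::comm_monoid_add"
  assumes "P 0" "\<And>x y. P x \<Longrightarrow> P y \<Longrightarrow> P (x + y)"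
    and "\<And>k. k \<in> Poly_Mapping.keys x \<Longrightarrow> P (Poly_Mapping.single k (Poly_Mapping.lookup x k))"
  shows "P x"
proof -
  have "P (\<Sum>k\<in>S. Poly_Mapping.single k (Poly_Mapping.lookup x k))"
    if "finite S" "S \<subseteq> Poly_Mapping.keys x" for S
    using that by (induction S) (auto simp: assms)
  from this[of "Poly_Mapping.keys x"] show ?thesis by (simp add: sum_single)
qed

lemma scal_mult: "scal c * p = scale c p"
  by (simp add: scal_def scale_def mult_map_scale_conv_mult zero_list_def)

lemma scal_commute: "p * scal c = scal c * (p :: 'k::field falg)"
proof (induction p rule: poly_mapping_induct_single)
  case (single k d)
  then show ?case by (simp add: scal_def mult_single plus_list_def mult.commute)
qed (simp_all add: algebra_simps)

lemma scal_simps: "scal 1 = 1" "scal 0 = 0" "scal c * scal d = scal (c * d)"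
  "scal (c + d) = scal c + scal d" "scal (c - d) = scal c - scal d"
  by (simp_all add: scal_def mult_single single_add single_diff flip: zero_list_def)

definition lin_ext :: "('a \<Rightarrow> ('b \<Rightarrow>\<^sub>0 'k)) \<Rightarrow> ('a \<Rightarrow>\<^sub>0 'k::field) \<Rightarrow> ('b \<Rightarrow>\<^sub>0 'k)" where
  "lin_ext f x = (\<Sum>k\<in>Poly_Mapping.keys x. scale (Poly_Mapping.lookup x k) (f k))"

lemma lin_ext_superset:
  "finite S \<Longrightarrow> Poly_Mapping.keys x \<subseteq> S \<Longrightarrow> lin_ext f x = (\<Sum>k\<in>S. scale (Poly_Mapping.lookup x k) (f k))"
  unfolding lin_ext_def by (rule sum.mono_neutral_left) (auto simp: in_keys_iff)

lemma lin_ext_zero [simp]: "lin_ext f 0 = 0"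
  by (simp add: lin_ext_def)

lemma lin_ext_single [simp]: "lin_ext f (Poly_Mapping.single k c) = scale c (f k)"
  by (simp add: lin_ext_def)

lemma lin_ext_add: "lin_ext f (x + y) = lin_ext f x + lin_ext f y"
proof -
  let ?S = "Poly_Mapping.keys x \<union> Poly_Mapping.keys y"
  show ?thesis
    using Poly_Mapping.keys_add[of x y]
    by (simp add: lin_ext_superset[of ?S] lookup_add scale_add sum.distrib)
qed

lemma lin_ext_minus: "lin_ext f (x - y) = lin_ext f x - lin_ext f y"
  using lin_ext_add[of f "x - y" y] by simp

lemma lin_ext_scale: "lin_ext f (scale c x) = scale c (lin_ext f x)"
proof -
  have "Poly_Mapping.keys (scale c x) \<subseteq> Poly_Mapping.keys x" by (auto simp: in_keys_iff)
  then show ?thesis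
    by (simp add: lin_ext_superset[of "Poly_Mapping.keys x"] scale_sum)
qed

lemma V_gen_lin_ext: "V_gen q lam g = lin_ext (V_basis q lam g)"
  by (rule ext) (simp add: V_gen_def lin_ext_def scale_def)

lemma V_free_lin_ext: "V_free q lam p x = lin_ext (\<lambda>w. foldr (V_gen q lam) w x) p"
  by (simp add: V_free_def lin_ext_def scale_def)

section \<open>The action of \<open>U\<close> on \<open>V(\<lambda>)\<close>\<close>

lemma V_gen_add: "V_gen q lam g (x + y) = V_gen q lam g x + V_gen q lam g y"
  and V_gen_scale: "V_gen q lam g (scale c x) = scale c (V_gen q lam g x)"
  and V_gen_zero [simp]: "V_gen q lam g 0 = 0"
  and V_gen_single [simp]: "V_gen q lam g (Poly_Mapping.single j c) = scale c (V_basis q lam g j)"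
  by (simp_all add: V_gen_lin_ext lin_ext_add lin_ext_scale)

lemma V_gen_I2 [simp]: "V_gen q lam (GE I2) x = 0" "V_gen q lam (GF I2) x = 0"
  by (simp_all add: V_gen_def flip: scale_def)

lemma V_word_add: "foldr (V_gen q lam) w (x + y) = foldr (V_gen q lam) w x + foldr (V_gen q lam) w y"
  by (induction w) (simp_all add: V_gen_add)

lemma V_word_scale: "foldr (V_gen q lam) w (scale c x) = scale c (foldr (V_gen q lam) w x)"
  by (induction w) (simp_all add: V_gen_scale)

lemma V_free_single: "V_free q lam (Poly_Mapping.single w c) x = scale c (foldr (V_gen q lam) w x)"
  and V_free_add: "V_free q lam (p + r) x = V_free q lam p x + V_free q lam r x"
  and V_free_minus: "V_free q lam (p - r) x = V_free q lam p x - V_free q lam r x"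
  and V_free_zero [simp]: "V_free q lam 0 x = 0"
  by (simp_all add: V_free_lin_ext lin_ext_add lin_ext_minus)

lemma V_free_gen_elt: "V_free q lam (gen_elt g) x = V_gen q lam g x"
  and V_free_scal: "V_free q lam (scal c) x = scale c x"
  and V_free_one: "V_free q lam 1 x = x"
  by (simp_all add: gen_elt_def scal_def V_free_single zero_list_def flip: single_one)

lemma V_free_add_right: "V_free q lam p (x + y) = V_free q lam p x + V_free q lam p y"
  by (induction p rule: poly_mapping_induct_single)
     (simp_all add: V_free_single V_free_add V_word_add scale_add ac_simps)

lemma V_free_scale_right: "V_free q lam p (scale c x) = scale c (V_free q lam p x)"
  by (induction p rule: poly_mapping_induct_single)
     (simp_all add: V_free_single V_free_add V_word_scale scale_add mult.commute)

lemma V_free_zero_right [simp]: "V_free q lam p 0 = 0"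
  using V_free_scale_right[of q lam p 0 0] by simp

lemma V_free_mult: "V_free q lam (p * r) x = V_free q lam p (V_free q lam r x)"
proof (induction p rule: poly_mapping_induct_single)
  case p: (single w c)
  show ?case
    by (induction r rule: poly_mapping_induct_single)
       (simp_all add: V_free_single V_free_add V_free_add_right mult_single plus_list_def
         V_word_scale V_word_add scale_add distrib_left)
qed (simp add: V_free_add distrib_right)

text \<open>
  The recursion for the coefficients of \<open>E\<^sub>1\<close>. It is what makes the commutator of \<open>E\<^sub>1\<close> and \<open>F\<^sub>1\<close>
  act correctly on \<open>V(\<lambda>)\<close>, and also what determines \<open>E\<^sub>1F\<^sub>1\<^bsup>j\<^esup>v\<close> for a highest weight vector \<open>v\<close> of any
  module: there \<open>a q\<^bsup>-2j\<^esup>\<close> is the eigenvalue of \<open>K\<^sub>1\<close> on \<open>F\<^sub>1\<^bsup>j\<^esup>v\<close>.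
\<close>

lemma qint_qbracket_step:
  fixes q :: "'k::field"
  assumes "q \<noteq> 0" "a \<noteq> 0" "q * q \<noteq> 1"
  shows "qint q (int j + 1) * qbracket q a (- int j)
       = qint q (int j) * qbracket q a (1 - int j)
         + (a * q powi (- 2 * int j) - inverse (a * q powi (- 2 * int j))) / (q - inverse q)"
proof -
  \<comment> \<open>With the inverses as separate variables the claim becomes, after clearing the denominator \<open>d\<^sup>2\<close>,
    an identity of polynomials.\<close>
  define t T Q A d where "t = q ^ j" and "T = inverse t" and "Q = inverse q"
    and "A = inverse a" and "d = q - Q"
  have ne: "t \<noteq> 0" "d \<noteq> 0" and inv: "t * T = 1" "q * Q = 1" "a * A = 1"
    using assms by (auto simp: t_def T_def Q_def A_def d_def field_simps)
  have pw: "q powi int j = t" "q powi (- int j) = T" "q powi (int j + 1) = t * q"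
    "q powi (- (int j + 1)) = T * Q" "q powi (1 - int j) = q * T" "q powi (- (1 - int j)) = t * Q"
    "q powi (- 2 * int j) = T * T"
    using assms(1)
    by (simp_all add: t_def T_def Q_def power_int_add power_int_diff power_int_minus power_mult
        power_int_mult field_simps power2_eq_square)
  have lhs: "qint q (int j + 1) * qbracket q a (- int j) = (t * q - T * Q) * (a * T - A * t) / (d * d)"
    unfolding qint_def qbracket_def minus_minus pw by (simp add: d_def Q_def A_def)
  have rhs: "qint q (int j) * qbracket q a (1 - int j) = (t - T) * (a * q * T - A * t * Q) / (d * d)"
    unfolding qint_def qbracket_def pw by (simp add: d_def Q_def A_def mult.assoc)
  have k: "(a * q powi (- 2 * int j) - inverse (a * q powi (- 2 * int j))) / (q - inverse q)
      = (a * T * T - A * t * t) * d / (d * d)"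
    unfolding pw using ne by (simp add: d_def Q_def A_def T_def mult.assoc)
  have "(t * q - T * Q) * (a * T - A * t)
      = (t - T) * (a * q * T - A * t * Q) + (a * T * T - A * t * t) * d"
    unfolding d_def by (simp add: algebra_simps)
  then show ?thesis
    unfolding lhs rhs k by (simp add: add_divide_distrib)
qed

lemma powi_shift:
  fixes q :: "'k::field"
  assumes "q \<noteq> 0"
  shows "q powi int (Suc j) = q * q powi int j" "q powi (- 2 * int (Suc j)) = q powi (- 2 * int j) / (q * q)"
proof -
  show "q powi int (Suc j) = q * q powi int j"
    using assms by (simp add: power_int_add)
  have "q powi (- 2 * int (Suc j)) = q powi (- 2 * int j - 2)"
    by (rule arg_cong[where f = "\<lambda>n. q powi n"]) simp
  also have "\<dots> = q powi (- 2 * int j) / q powi 2" by (rule power_int_diff) (use assms in simp)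
  finally show "q powi (- 2 * int (Suc j)) = q powi (- 2 * int j) / (q * q)"
    by (simp add: power2_eq_square)
qed

text \<open>
  By linearity the relations need checking on basis vectors only, where each is an identity between
  scalars. As \<open>E\<^sub>2\<close> and \<open>F\<^sub>2\<close> act by zero, the Serre relations are trivial: each of their terms contains
  a generator of index 2. The one relation with content is the commutator of \<open>E\<^sub>1\<close> and \<open>F\<^sub>1\<close>.
\<close>

lemma V_relations:
  fixes q :: "'k::field"
  assumes "q \<noteq> 0" "q * q \<noteq> 1" and lam: "\<forall>i. lam i \<noteq> 0" and r: "r \<in> U_relations q"
  shows "V_free q lam r x = 0"
proof (induction x rule: poly_mapping_induct_single)
  case (single j c)
  define s where "s k = lam I1 * q powi (- 2 * int k)" for k
  define t where "t k = lam I2 * q powi int k" for k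
  have nz: "s k \<noteq> 0" "t k \<noteq> 0" for k
    using lam assms(1) by (simp_all add: s_def t_def)
  have shift: "s (Suc k) = s k / (q * q)" "t (Suc k) = q * t k" for k
    unfolding s_def t_def powi_shift[OF assms(1)] by simp_all
  have K [simp]: "V_basis q lam (GK I1) k = Poly_Mapping.single k (s k)"
    "V_basis q lam (GKinv I1) k = Poly_Mapping.single k (inverse (s k))"
    "V_basis q lam (GK I2) k = Poly_Mapping.single k (t k)"
    "V_basis q lam (GKinv I2) k = Poly_Mapping.single k (inverse (t k))" for k
    by (simp_all add: s_def t_def)
  have E [simp]: "V_basis q lam (GE I1) 0 = 0"
    "V_basis q lam (GE I1) (Suc k)
      = Poly_Mapping.single k (qint q (int k + 1) * qbracket q (lam I1) (- int k))" for k
    by (simp_all add: add.commute)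
  note step = qint_qbracket_step[OF assms(1) lam[rule_format, of I1] assms(2), folded s_def]
  note [simp] = V_free_minus V_free_add V_free_mult V_free_gen_elt V_free_scal V_free_one
  note [simp del] = V_basis.simps(1-4,6)
  consider i i' where "r = KK i * KK i' - KK i' * KK i"
    | i where "r = KK i * KI i - 1" | i where "r = KI i * KK i - 1"
    | i i' where "r = KK i * EE i' * KI i - scal (q powi cartan i' i) * EE i'"
    | i i' where "r = KK i * FF i' * KI i - scal (q powi (- cartan i' i)) * FF i'"
    | "r = EE I1 * FF I1 - FF I1 * EE I1 - scal (1 / (q - inverse q)) * (KK I1 - KI I1)"
    | i i' where "r = EE i * FF i' - FF i' * EE i" "(i, i') \<noteq> (I1, I1)"
    | i i' where "i \<noteq> i'"
        "r = EE i * EE i * EE i' - scal (q + inverse q) * EE i * EE i' * EE i + EE i' * EE i * EE i"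
    | i i' where "i \<noteq> i'"
        "r = FF i * FF i * FF i' - scal (q + inverse q) * FF i * FF i' * FF i + FF i' * FF i * FF i"
    using r unfolding U_relations_def by blast
  then show ?case
  proof cases
    case (1 i i')
    then show ?thesis by (cases i; cases i') (simp_all add: ac_simps)
  next
    case (2 i)
    then show ?thesis using nz by (cases i) (simp_all add: mult.assoc)
  next
    case (3 i)
    then show ?thesis using nz by (cases i) (simp_all add: mult.assoc)
  next
    case (4 i i')
    show ?thesis
      unfolding 4 using nz assms(1) by (cases i; cases i'; cases j)
        (simp_all add: cartan_def shift power_int_minus power2_eq_square field_simps)
  next
    case (5 i i')
    show ?thesis
      unfolding 5 using nz assms(1) by (cases i; cases i'; cases j)
        (simp_all add: cartan_def shift power_int_minus power2_eq_square field_simps)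
  next
    case 6
    define e where "e k = qint q (int k) * qbracket q (lam I1) (1 - int k)" for k
    have e: "e (Suc k) = e k + (s k - inverse (s k)) / (q - inverse q)" for k
      using step[of k] by (simp add: e_def add.commute)
    have "e 0 = 0" by (simp add: e_def qint_def)
    have "V_basis q lam (GE I1) (Suc k) = Poly_Mapping.single k (e (Suc k))" for k
      by (simp add: e_def add.commute)
    then have "V_free q lam r (Poly_Mapping.single j c)
        = Poly_Mapping.single j (c * (e (Suc j) - e j - (s j - inverse (s j)) / (q - inverse q)))"
      unfolding 6 using \<open>e 0 = 0\<close>
      by (cases j) (simp_all del: E(2) add: scale_minus algebra_simps diff_divide_distrib
        flip: single_diff single_add)
    then show ?thesis by (simp add: e)
  next
    case (7 i i')
    then show ?thesis by (cases i; cases i'; cases j) simp_all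
  next
    case (8 i i')
    then show ?thesis by (cases i; cases i') simp_all
  next
    case (9 i i')
    then show ?thesis by (cases i; cases i') simp_all
  qed
qed (simp add: V_free_add_right)

text \<open>
  The elements acting by zero on all of \<open>V(\<lambda>)\<close> form a two-sided ideal, and it contains the relations.
\<close>

lemma V_free_U_ideal:
  fixes q :: "'k::field"
  assumes "q \<noteq> 0" "q * q \<noteq> 1" "\<forall>i. lam i \<noteq> 0" "p \<in> U_ideal q"
  shows "V_free q lam p x = 0"
proof -
  let ?I = "{p. \<forall>x. V_free q lam p x = 0}"
  interpret ring "free_alg :: 'k falg ring" by (rule ring_free_alg)
  have "subgroup ?I (add_monoid free_alg)"
  proof (rule add.subgroupI)
    show "?I \<noteq> {}" by (auto intro: exI[of _ 0])
    show "\<ominus>\<^bsub>free_alg\<^esub> a \<in> ?I" if "a \<in> ?I" for a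
      using that V_free_minus[of q lam 0 a] by (simp add: a_inv_free_alg)
  qed (auto simp: V_free_add)
  then have "ideal ?I free_alg"
    by (rule idealI[OF ring_free_alg]) (auto simp: V_free_mult)
  then have "U_ideal q \<subseteq> ?I"
    unfolding U_ideal_def using V_relations[OF assms(1-3)] by (intro genideal_minimal) auto
  with assms(4) show ?thesis by blast
qed

text \<open>
  The action of a class is thus that of any of its representatives: the image whose \<^const>\<open>the_elem\<close>
  is taken in the definition of \<open>V(\<lambda>)\<close> is a singleton.
\<close>

lemma V_smult:
  fixes q :: "'k::field"
  assumes "q \<noteq> 0" "q * q \<noteq> 1" "\<forall>i. lam i \<noteq> 0"
  shows "cls q p \<odot>\<^bsub>V q lam\<^esub> x = V_free q lam p x"
proof -
  have "(\<lambda>r. V_free q lam r x) ` cls q p = {V_free q lam p x}"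
  proof -
    have "(\<lambda>r. V_free q lam r x) ` cls q p = (\<lambda>r. V_free q lam p x) ` cls q p"
    proof (rule image_cong[OF refl])
      fix r assume "r \<in> cls q p"
      then show "V_free q lam r x = V_free q lam p x"
        using V_free_U_ideal[OF assms, of "r - p" x] by (simp add: mem_cls_iff V_free_minus)
    qed
    moreover have "p \<in> cls q p"
      using additive_subgroup.zero_closed[OF ideal.axioms(1)[OF ideal_U_ideal[of q]]]
      by (simp add: mem_cls_iff)
    ultimately show ?thesis by auto
  qed
  then show ?thesis by (simp add: V_def)
qed

section \<open>Modules over \<open>U\<close>\<close>

text \<open>
  A module over \<open>U\<close> is handled through the action of the free algebra. Computations with relations then
  take place in a type class ring, and cosets do not appear in them.
\<close>

locale U_module = left_module "U q" M
  for q :: "'k::field" and M :: "('k falg set, 'm) module" (structure)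
begin

definition act :: "'k falg \<Rightarrow> 'm \<Rightarrow> 'm" where
  "act p x = cls q p \<odot> x"

abbreviation sc :: "'k \<Rightarrow> 'm \<Rightarrow> 'm" where "sc c \<equiv> act (scal c)"
abbreviation ac :: "gen \<Rightarrow> 'm \<Rightarrow> 'm" where "ac g \<equiv> act (gen_elt g)"

lemma act_closed [simp]: "x \<in> carrier M \<Longrightarrow> act p x \<in> carrier M"
  by (simp add: act_def smult_closed)

lemma act_add: "x \<in> carrier M \<Longrightarrow> act (p + r) x = act p x \<oplus> act r x"
  using smult_l_distr[of "cls q p" "cls q r" x] by (simp add: act_def)

lemma act_add_right: "x \<in> carrier M \<Longrightarrow> y \<in> carrier M \<Longrightarrow> act p (x \<oplus> y) = act p x \<oplus> act p y"
  by (simp add: act_def smult_r_distr)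

lemma act_mult: "x \<in> carrier M \<Longrightarrow> act (p * r) x = act p (act r x)"
  using smult_assoc[of "cls q p" "cls q r" x] by (simp add: act_def)

lemma act_one [simp]: "x \<in> carrier M \<Longrightarrow> act 1 x = x"
  using smult_one[of x] by (simp add: act_def)

lemma act_zero_right [simp]: "act p \<zero> = \<zero>"
  using act_add_right[of \<zero> \<zero> p] by (simp add: M.add.l_cancel_one')

lemma act_zero [simp]: "x \<in> carrier M \<Longrightarrow> act 0 x = \<zero>"
  using act_add[of x 0 0] by simp

lemma act_minus: "x \<in> carrier M \<Longrightarrow> act (p - r) x = act p x \<ominus> act r x"
  using act_add[of x "p - r" r] by (simp add: M.minus_eq M.a_assoc M.r_neg)

lemma act_neg: "x \<in> carrier M \<Longrightarrow> \<ominus> x = sc (- 1) x"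
proof -
  assume x: "x \<in> carrier M"
  have "x \<oplus> sc (- 1) x = act (scal 1 + scal (- 1)) x"
    using x by (simp add: act_add scal_simps)
  also have "\<dots> = \<zero>"
    using x unfolding scal_simps(4)[symmetric] by (simp add: scal_simps(2))
  finally show ?thesis using x by (simp add: M.add.inv_equality M.a_comm)
qed

lemma act_scal_commute: "x \<in> carrier M \<Longrightarrow> act p (sc c x) = sc c (act p x)"
  by (simp add: scal_commute flip: act_mult)

lemma sc_sc: "x \<in> carrier M \<Longrightarrow> sc c (sc d x) = sc (c * d) x"
  by (simp add: scal_simps flip: act_mult)

lemma sc_one [simp]: "x \<in> carrier M \<Longrightarrow> sc 1 x = x"
  by (simp add: scal_simps)

lemma act_cong: "p - r \<in> U_relations q \<Longrightarrow> act p x = act r x"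
  using cls_eqI[of p r q] U_relations_subset[of q] by (auto simp: act_def)

lemma KI_K: "x \<in> carrier M \<Longrightarrow> ac (GKinv i) (ac (GK i) x) = x"
  using act_cong[of "KI i * KK i" 1 x] by (auto simp: U_relations_def act_mult)

lemma K_KI: "x \<in> carrier M \<Longrightarrow> ac (GK i) (ac (GKinv i) x) = x"
  using act_cong[of "KK i * KI i" 1 x] by (auto simp: U_relations_def act_mult)

lemma K_F:
  assumes "x \<in> carrier M"
  shows "ac (GK i) (ac (GF j) x) = sc (q powi (- cartan j i)) (ac (GF j) (ac (GK i) x))"
proof -
  have "KK i * FF j * KI i - scal (q powi (- cartan j i)) * FF j \<in> U_relations q"
    unfolding U_relations_def by blast
  from act_cong[OF this, of "ac (GK i) x"] show ?thesis
    using assms by (simp add: act_mult KI_K)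
qed

text \<open>
  The relations say how \<open>K\<^sub>i\<close> passes \<open>F\<^sub>j\<close>; writing a vector as \<open>K\<^sub>i\<close> of \<open>K\<^sub>i\<^sup>-\<^sup>1x\<close> turns this into the rule
  for the inverse.
\<close>

lemma KI_F:
  assumes "x \<in> carrier M" "q \<noteq> 0"
  shows "ac (GKinv i) (ac (GF j) x) = sc (q powi cartan j i) (ac (GF j) (ac (GKinv i) x))"
proof -
  let ?y = "ac (GKinv i) x"
  have "ac (GF j) ?y = ac (GKinv i) (ac (GK i) (ac (GF j) ?y))"
    using assms by (simp add: KI_K)
  also have "\<dots> = sc (q powi (- cartan j i)) (ac (GKinv i) (ac (GF j) x))"
    using assms by (simp add: K_F K_KI act_scal_commute)
  finally show ?thesis
    using assms by (simp add: sc_sc power_int_minus)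
qed

lemma E_F:
  assumes "x \<in> carrier M" "(i, j) \<noteq> (I1, I1)"
  shows "ac (GE i) (ac (GF j) x) = ac (GF j) (ac (GE i) x)"
proof -
  have "EE i * FF j - FF j * EE i \<in> U_relations q"
    using assms(2) unfolding U_relations_def by blast
  from act_cong[OF this, of x] show ?thesis using assms by (simp add: act_mult)
qed

lemma E1_F1:
  assumes "x \<in> carrier M"
  shows "ac (GE I1) (ac (GF I1) x) = ac (GF I1) (ac (GE I1) x)
    \<oplus> sc (1 / (q - inverse q)) (ac (GK I1) x \<ominus> ac (GKinv I1) x)"
proof -
  have "EE I1 * FF I1 - (FF I1 * EE I1 + scal (1 / (q - inverse q)) * (KK I1 - KI I1)) \<in> U_relations q"
    unfolding U_relations_def diff_diff_eq[symmetric] by blast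
  from act_cong[OF this, of x] show ?thesis using assms by (simp add: act_mult act_add act_minus)
qed

lemma act_closed_under:
  assumes x: "x \<in> N" and N: "N \<subseteq> carrier M"
    and add: "\<And>x y. x \<in> N \<Longrightarrow> y \<in> N \<Longrightarrow> x \<oplus> y \<in> N"
    and scal: "\<And>c x. x \<in> N \<Longrightarrow> sc c x \<in> N"
    and gen: "\<And>g x. x \<in> N \<Longrightarrow> ac g x \<in> N"
  shows "act p x \<in> N"
proof (induction p rule: poly_mapping_induct_single)
  case (single w c)
  have "act (Poly_Mapping.single w 1) x \<in> N"
  proof (induction w)
    case Nil
    then show ?case using x N by (auto simp flip: zero_list_def)
  next
    case (Cons g w)
    have "Poly_Mapping.single (g # w) 1 = gen_elt g * Poly_Mapping.single w (1 :: 'k)"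
      by (simp add: gen_elt_def mult_single plus_list_def)
    then show ?case using Cons gen x N by (auto simp: act_mult)
  qed
  moreover have "Poly_Mapping.single w c = scal c * Poly_Mapping.single w 1"
    by (simp add: scal_def mult_single plus_list_def)
  ultimately show ?case using x N scal by (auto simp: act_mult)
next
  case (add p r)
  then show ?case using x N assms(3) by (auto simp: act_add)
qed

lemma submodule_criterion:
  assumes N: "N \<subseteq> carrier M" and zero: "\<zero> \<in> N"
    and add: "\<And>x y. x \<in> N \<Longrightarrow> y \<in> N \<Longrightarrow> x \<oplus> y \<in> N"
    and scal: "\<And>c x. x \<in> N \<Longrightarrow> sc c x \<in> N"
    and gen: "\<And>g x. x \<in> N \<Longrightarrow> ac g x \<in> N"
  shows "submodule N (U q) M"
proof -
  have "subgroup N (add_monoid M)"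
  proof (rule M.add.subgroupI)
    show "\<ominus> x \<in> N" if "x \<in> N" for x
      using that N scal[OF that, of "- 1"] by (auto simp: act_neg)
  qed (use assms in auto)
  moreover have "a \<odot> x \<in> N" if "a \<in> carrier (U q)" "x \<in> N" for a x
    using act_closed_under[OF that(2) N add scal gen] that(1) by (auto simp: carrier_U act_def)
  ultimately show ?thesis by (intro submodule.intro submodule_axioms.intro)
qed

text \<open>
  The general rule \<open>act_scal_commute\<close> does not terminate as a rewrite rule, because it applies to
  two scalars in turn; its instances for elements that are not scalars do.
\<close>

lemma ac_sc: "x \<in> carrier M \<Longrightarrow> ac g (sc c x) = sc c (ac g x)"
  by (rule act_scal_commute)

section \<open>Submodules spanned by words in \<open>F\<^sub>1\<close> and \<open>F\<^sub>2\<close>\<close>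

text \<open>
  The span of all words in \<open>F\<^sub>1, F\<^sub>2\<close> applied to elements of \<open>S\<close>. The inductive form turns arguments on the
  length of words into rule inductions.
\<close>

inductive_set F_span :: "'m set \<Rightarrow> 'm set" for S where
  base: "x \<in> S \<Longrightarrow> x \<in> F_span S"
| zero: "\<zero> \<in> F_span S"
| add: "x \<in> F_span S \<Longrightarrow> y \<in> F_span S \<Longrightarrow> x \<oplus> y \<in> F_span S"
| scal: "x \<in> F_span S \<Longrightarrow> sc c x \<in> F_span S"
| F: "x \<in> F_span S \<Longrightarrow> ac (GF i) x \<in> F_span S"

lemma F_span_carrier: "x \<in> F_span S \<Longrightarrow> S \<subseteq> carrier M \<Longrightarrow> x \<in> carrier M"
  by (induction rule: F_span.induct) auto

text \<open>
  The easy half of the triangular decomposition: \<open>K\<^sub>i\<close> passes \<open>F\<^sub>j\<close> up to a scalar, and \<open>E\<^sub>i\<close> passes \<open>F\<^sub>j\<close> up to a term in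
  the \<open>K\<close>'s, so stability under \<open>K\<^sub>i\<close> and \<open>E\<^sub>i\<close> is inherited from \<open>S\<close>.
\<close>

lemma submodule_F_span:
  assumes q: "q \<noteq> 0" and S: "S \<subseteq> carrier M"
    and K: "\<And>i s. s \<in> S \<Longrightarrow> ac (GK i) s \<in> F_span S"
    and KI: "\<And>i s. s \<in> S \<Longrightarrow> ac (GKinv i) s \<in> F_span S"
    and E: "\<And>i s. s \<in> S \<Longrightarrow> ac (GE i) s \<in> F_span S"
  shows "submodule (F_span S) (U q) M"
proof -
  note carr = F_span_carrier[OF _ S]
  have K': "ac (GK i) x \<in> F_span S" if "x \<in> F_span S" for i x
    using that
    by (induction rule: F_span.induct)
       (auto simp: K act_add_right ac_sc K_F carr intro: F_span.intros)
  have KI': "ac (GKinv i) x \<in> F_span S" if "x \<in> F_span S" for i x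
    using that
    by (induction rule: F_span.induct)
       (auto simp: KI act_add_right ac_sc KI_F[OF _ q] carr intro: F_span.intros)
  have neg: "x \<ominus> y \<in> F_span S" if "x \<in> F_span S" "y \<in> F_span S" for x y
    using that by (auto simp: M.minus_eq act_neg carr intro: F_span.intros)
  have E': "ac (GE i) x \<in> F_span S" if "x \<in> F_span S" for i x
    using that
  proof (induction rule: F_span.induct)
    case (F x j)
    show ?case
    proof (cases "(i, j) = (I1, I1)")
      case True
      then show ?thesis
        using F by (auto simp: E1_F1 carr intro!: F_span.add F_span.scal F_span.F neg K' KI')
    next
      case False
      then show ?thesis using F by (auto simp: E_F carr intro: F_span.intros)
    qed
  qed (auto simp: E act_add_right ac_sc carr intro: F_span.intros)
  show ?thesis
  proof (rule submodule_criterion)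
    fix g x assume "x \<in> F_span S"
    then show "ac g x \<in> F_span S"
      using K' KI' E' F_span.F by (cases g) auto
  qed (auto intro: F_span.intros carr)
qed

text \<open>
  The grading that counts occurrences of \<open>F\<^sub>2\<close>: since \<open>a\<^sub>1\<^sub>1 + 2 a\<^sub>1\<^sub>2 = 0\<close>, the element \<open>K\<^sub>1K\<^sub>2\<^sup>2\<close> commutes with \<open>F\<^sub>1\<close>, while
  passing \<open>F\<^sub>2\<close> costs the factor \<open>q\<^sup>-\<^sup>3\<close>, as \<open>a\<^sub>2\<^sub>1 + 2 a\<^sub>2\<^sub>2 = 3\<close>. Its eigenvalues separate vectors by
  the number of \<open>F\<^sub>2\<close>'s used to build them from a vector of fixed weight.
\<close>

definition K12 :: "'k falg" where "K12 = KK I1 * KK I2 * KK I2"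

lemma K12_F1: "q \<noteq> 0 \<Longrightarrow> x \<in> carrier M \<Longrightarrow> act K12 (ac (GF I1) x) = ac (GF I1) (act K12 x)"
  by (simp add: K12_def act_mult K_F ac_sc sc_sc cartan_def power_int_minus power2_eq_square
      field_simps)

lemma K12_F2: "q \<noteq> 0 \<Longrightarrow> x \<in> carrier M \<Longrightarrow>
  act K12 (ac (GF I2) x) = sc (inverse q ^ 3) (ac (GF I2) (act K12 x))"
  by (simp add: K12_def act_mult K_F ac_sc sc_sc cartan_def power_int_minus
      power2_eq_square power3_eq_cube field_simps)

text \<open>
  If this product kills \<open>x\<close>, then \<open>x\<close> has no component in the eigenspaces of \<open>K\<^sub>1K\<^sub>2\<^sup>2\<close> whose eigenvalue is
  missing from the list. Products of shifts express this without decomposing \<open>x\<close> into eigenvectors.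
\<close>

primrec shifted_prod :: "'k list \<Rightarrow> 'k falg" where
  "shifted_prod [] = 1"
| "shifted_prod (c # l) = shifted_prod l * (K12 - scal c)"

lemma K12_sc: "x \<in> carrier M \<Longrightarrow> act K12 (sc c x) = sc c (act K12 x)"
  and shifted_prod_sc: "x \<in> carrier M \<Longrightarrow> act (shifted_prod l) (sc c x) = sc c (act (shifted_prod l) x)"
  by (rule act_scal_commute; assumption)+

lemmas sc_out = ac_sc K12_sc shifted_prod_sc

lemma shifted_prod_commute:
  "(K12 - scal c) * shifted_prod l = shifted_prod l * (K12 - scal c)"
proof (induction l)
  case (Cons d l)
  have "(K12 - scal c) * (K12 - scal d) = (K12 - scal d) * (K12 - scal c)"
    by (simp only: left_diff_distrib right_diff_distrib scal_commute[of K12 c] scal_commute[of K12 d]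
        scal_commute[of "scal c" d]) (simp add: algebra_simps)
  moreover have "(K12 - scal c) * shifted_prod (d # l) = shifted_prod l * ((K12 - scal c) * (K12 - scal d))"
    by (simp only: shifted_prod.simps mult.assoc[symmetric] Cons)
  ultimately show ?case by (simp add: mult.assoc)
qed simp

lemma shifted_prod_append:
  "shifted_prod (l @ l') = shifted_prod l' * shifted_prod l"
  "shifted_prod (l @ l') = shifted_prod l * shifted_prod l'"
proof -
  show "shifted_prod (l @ l') = shifted_prod l' * shifted_prod l"
    by (induction l) (simp_all add: mult.assoc)
  show "shifted_prod (l @ l') = shifted_prod l * shifted_prod l'"
    by (induction l) (simp_all add: mult.assoc shifted_prod_commute)
qed

lemma shifted_prod_F1:
  "q \<noteq> 0 \<Longrightarrow> x \<in> carrier M \<Longrightarrow>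
    act (shifted_prod l) (ac (GF I1) x) = ac (GF I1) (act (shifted_prod l) x)"
proof (induction l arbitrary: x)
  case (Cons c l)
  have "act (K12 - scal c) (ac (GF I1) x) = ac (GF I1) (act (K12 - scal c) x)"
    using Cons.prems by (simp add: act_minus K12_F1 sc_out M.minus_eq act_neg act_add_right)
  then show ?case using Cons by (simp add: act_mult)
qed simp

text \<open>
  Applying \<open>F\<^sub>2\<close> multiplies eigenvalues of \<open>K\<^sub>1K\<^sub>2\<^sup>2\<close> by \<open>q\<^sup>-\<^sup>3\<close>.
\<close>

lemma shifted_prod_F2:
  "q \<noteq> 0 \<Longrightarrow> x \<in> carrier M \<Longrightarrow> act (shifted_prod l) x = \<zero> \<Longrightarrow>
    act (shifted_prod (map ((*) (inverse q ^ 3)) l)) (ac (GF I2) x) = \<zero>"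
proof (induction l arbitrary: x)
  case (Cons c l)
  let ?r = "inverse q ^ 3"
  have "act (K12 - scal (?r * c)) (ac (GF I2) x) = sc ?r (ac (GF I2) (act (K12 - scal c) x))"
    using Cons.prems
    by (simp add: act_minus K12_F2 sc_out M.minus_eq act_neg act_add_right sc_sc ac_simps)
  then show ?case using Cons by (simp add: act_mult sc_out)
qed simp

lemma shifted_prod_eigen:
  "x \<in> carrier M \<Longrightarrow> act K12 x = sc a x \<Longrightarrow>
    act (shifted_prod l) x = sc (\<Prod>c\<leftarrow>l. a - c) x"
proof (induction l)
  case (Cons c l)
  have "act (K12 - scal c) x = sc (a - c) x"
    using Cons.prems by (simp add: act_minus scal_simps)
  then show ?case using Cons by (simp add: act_mult sc_out sc_sc mult.commute)
qed simp

end

section \<open>The orbit of a highest weight vector under \<open>F\<^sub>1\<close>\<close>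

locale highest_weight = U_module +
  fixes lam :: "idx \<Rightarrow> 'a" and v :: 'b
  assumes q0: "q \<noteq> 0" and not_root: "\<And>n::nat. n > 0 \<Longrightarrow> q ^ n \<noteq> 1"
    and lam0: "\<And>i. lam i \<noteq> 0"
    and hwv: "highest_weight_vector q M lam v"
begin

lemma v_carrier [simp]: "v \<in> carrier M" and v_nonzero: "v \<noteq> \<zero>"
  and K_v: "ac (GK i) v = sc (lam i) v" and E_v: "ac (GE i) v = \<zero>"
  using hwv by (simp_all add: highest_weight_vector_def weight_vector_def act_def)

lemma qq: "q * q \<noteq> 1"
  using not_root[of 2] by (simp add: power2_eq_square)

lemma qpow_inj: "q ^ a = q ^ b \<Longrightarrow> a = b"
proof (induction a b rule: linorder_wlog)
  case (le a b)
  have "q ^ a * q ^ (b - a) = q ^ b" using \<open>a \<le> b\<close> by (simp flip: power_add)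
  then have "q ^ (b - a) = 1" using q0 le(2) by simp
  then show ?case using not_root[of "b - a"] le by (cases "b - a = 0") auto
qed simp

definition w :: "nat \<Rightarrow> 'b" where "w j = (ac (GF I1) ^^ j) v"

lemma w_simps: "w 0 = v" "w (Suc j) = ac (GF I1) (w j)"
  by (simp_all add: w_def)

lemma w_carrier [simp]: "w j \<in> carrier M"
  by (induction j) (simp_all add: w_simps)

text \<open>
  The eigenvalue of \<open>K\<^sub>i\<close> on \<open>F\<^sub>1\<^bsup>j\<^esup>v\<close>. It is the one that \<^const>\<open>V_basis\<close> gives to the \<open>j\<close>-th basis vector,
  because \<open>a\<^sub>1\<^sub>1 = 2\<close> and \<open>a\<^sub>1\<^sub>2 = -1\<close>.
\<close>

definition wt :: "idx \<Rightarrow> nat \<Rightarrow> 'a" where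
  "wt i j = lam i * q powi (- cartan I1 i * int j)"

lemma wt_simps: "wt i 0 = lam i" "wt i (Suc j) = q powi (- cartan I1 i) * wt i j" "wt i j \<noteq> 0"
proof -
  have "q powi (- cartan I1 i * int (Suc j)) = q powi (- cartan I1 i + - cartan I1 i * int j)"
    by (rule arg_cong[where f = "\<lambda>n. q powi n"]) (simp add: algebra_simps)
  also have "\<dots> = q powi (- cartan I1 i) * q powi (- cartan I1 i * int j)"
    by (rule power_int_add) (use q0 in simp)
  finally show "wt i (Suc j) = q powi (- cartan I1 i) * wt i j"
    by (simp only: wt_def mult.left_commute)
qed (use q0 lam0 in \<open>simp_all add: wt_def\<close>)

lemma K_w: "ac (GK i) (w j) = sc (wt i j) (w j)"
  by (induction j) (simp_all add: w_simps wt_simps K_v K_F sc_out sc_sc)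

lemma K_eigen_KI: "x \<in> carrier M \<Longrightarrow> c \<noteq> 0 \<Longrightarrow> ac (GK i) x = sc c x \<Longrightarrow> ac (GKinv i) x = sc (inverse c) x"
proof -
  assume x: "x \<in> carrier M" "c \<noteq> 0" "ac (GK i) x = sc c x"
  have "sc (inverse c) x = sc (inverse c) (ac (GKinv i) (ac (GK i) x))"
    using x(1) by (simp add: KI_K)
  then show ?thesis unfolding x(3) using x(1,2) by (simp add: sc_out sc_sc)
qed

lemma KI_w: "ac (GKinv i) (w j) = sc (inverse (wt i j)) (w j)"
  by (rule K_eigen_KI) (simp_all add: K_w wt_simps)

definition ecoef :: "nat \<Rightarrow> 'a" where
  "ecoef j = qint q (int j) * qbracket q (lam I1) (1 - int j)"

lemma E1_w: "ac (GE I1) (w (Suc j)) = sc (ecoef (Suc j)) (w j)"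
proof -
  have step: "ecoef (Suc j) = ecoef j + (1 / (q - inverse q)) * (wt I1 j - inverse (wt I1 j))" for j
    using qint_qbracket_step[OF q0 lam0[of I1] qq, of j]
    by (simp add: ecoef_def wt_def cartan_def add.commute)
  have diff: "sc a (w j) \<ominus> sc b (w j) = sc (a - b) (w j)" for a b j
    by (simp add: act_minus scal_simps(5))
  have E1F1: "ac (GE I1) (w (Suc j)) = ac (GF I1) (ac (GE I1) (w j))
      \<oplus> sc (1 / (q - inverse q) * (wt I1 j - inverse (wt I1 j))) (w j)" for j
    by (simp add: w_simps E1_F1 K_w KI_w diff sc_sc)
  have "ecoef 0 = 0" by (simp add: ecoef_def qint_def)
  show ?thesis
  proof (induction j)
    case 0
    then show ?case using E1F1[of 0] \<open>ecoef 0 = 0\<close> by (simp add: step w_simps E_v)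
  next
    case (Suc j)
    then show ?case
      unfolding E1F1[of "Suc j"] step[of "Suc j"]
      by (simp add: sc_out w_simps(2)[symmetric] scal_simps(4) act_add)
  qed
qed

lemma E2_w: "ac (GE I2) (w j) = \<zero>"
  by (induction j) (simp_all add: w_simps E_v E_F)

definition mu :: 'a where "mu = lam I1 * lam I2 * lam I2"

lemma K12_w: "act K12 (w j) = sc mu (w j)"
proof (induction j)
  case 0
  then show ?case by (simp add: w_simps K12_def act_mult K_v sc_out sc_sc mu_def ac_simps)
qed (simp add: w_simps K12_F1 q0 sc_out)

text \<open>
  By the relations, the span of the vectors \<open>F\<^sub>2F\<^sub>1\<^bsup>j\<^esup>v\<close> is stable under \<open>E\<^sub>1\<close>
  and is killed by \<open>E\<^sub>2\<close>, because both \<open>E\<^sub>1\<close> and \<open>E\<^sub>2\<close> commute with \<open>F\<^sub>2\<close>; this is the feature that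
  distinguishes \<open>U\<close> from the usual quantum group. Hence the words in \<open>F\<^sub>1, F\<^sub>2\<close> applied to these vectors
  span a submodule. All its elements are built with at least one \<open>F\<^sub>2\<close>, so it lives in the eigenvalues
  \<open>\<mu> q\<^bsup>-3b\<^esup>\<close>, \<open>b \<ge> 1\<close>, of \<open>K\<^sub>1K\<^sub>2\<^sup>2\<close>, whereas \<open>v\<close> has eigenvalue \<open>\<mu>\<close>. As \<open>q\<close> is not a root of unity, \<open>v\<close> is not
  in it, and by simplicity it is zero.
\<close>

lemma F2_w_eq_zero:
  assumes simple: "simple_module (U q) M"
  shows "ac (GF I2) (w j) = \<zero>"
proof -
  define S where "S = range (\<lambda>j. ac (GF I2) (w j))"
  define r where "r = inverse q ^ 3"
  have S: "S \<subseteq> carrier M" by (auto simp: S_def)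
  have "submodule (F_span S) (U q) M"
  proof (rule submodule_F_span[OF q0 S])
    fix i s assume "s \<in> S"
    then obtain j where s: "s = ac (GF I2) (w j)" by (auto simp: S_def)
    have "w j \<in> carrier M" by simp
    have K: "ac (GK i) s = sc (q powi (- cartan I2 i) * wt i j) s"
      by (simp add: s K_F K_w sc_out sc_sc)
    then show "ac (GK i) s \<in> F_span S" using \<open>s \<in> S\<close> by (auto intro: F_span.intros)
    have "ac (GKinv i) s = sc (inverse (q powi (- cartan I2 i) * wt i j)) s"
      by (rule K_eigen_KI[OF _ _ K]) (use q0 wt_simps(3) in \<open>simp_all add: s\<close>)
    then show "ac (GKinv i) s \<in> F_span S" using \<open>s \<in> S\<close> by (auto intro: F_span.intros)
    show "ac (GE i) s \<in> F_span S"
    proof (cases i)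
      case I1
      show ?thesis
      proof (cases j)
        case 0
        then show ?thesis using I1 by (simp add: s E_F w_simps E_v F_span.zero)
      next
        case (Suc k)
        then have "ac (GE i) s = sc (ecoef (Suc k)) (ac (GF I2) (w k))"
          using I1 by (simp add: s E_F E1_w sc_out)
        then show ?thesis by (auto simp: S_def intro: F_span.intros)
      qed
    next
      case I2
      then show ?thesis by (simp add: s E_F E2_w F_span.zero)
    qed
  qed
  moreover have "v \<notin> F_span S"
  proof
    \<comment> \<open>The eigenvalues are written with \<open>Suc b\<close> so that \<open>\<mu>\<close> itself is excluded.\<close>
    have *: "\<exists>l. set l \<subseteq> {mu * r ^ Suc b | b. True} \<and> act (shifted_prod l) x = \<zero>" if "x \<in> F_span S" for x
      using that
    proof (induction rule: F_span.induct)
      case (base x)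
      then obtain j where x: "x = ac (GF I2) (w j)" by (auto simp: S_def)
      have "act (shifted_prod [mu * r]) x = \<zero>"
        by (simp add: x act_minus K12_F2 q0 K12_w sc_out sc_sc r_def mult.commute M.minus_eq M.r_neg)
      moreover have "set [mu * r] \<subseteq> {mu * r ^ Suc b | b. True}"
        by (auto intro: exI[of _ 0])
      ultimately show ?case by blast
    next
      case zero
      show ?case by (rule exI[of _ "[]"]) simp
    next
      case (add x y)
      then obtain l l' where l: "set l \<subseteq> {mu * r ^ Suc b | b. True}" "act (shifted_prod l) x = \<zero>"
        and l': "set l' \<subseteq> {mu * r ^ Suc b | b. True}" "act (shifted_prod l') y = \<zero>" by blast
      have xy: "x \<in> carrier M" "y \<in> carrier M" using add F_span_carrier[OF _ S] by auto
      have "act (shifted_prod (l @ l')) x = \<zero>"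
        using l xy by (simp add: shifted_prod_append(1) act_mult)
      moreover have "act (shifted_prod (l @ l')) y = \<zero>"
        using l' xy by (simp add: shifted_prod_append(2) act_mult)
      ultimately have "act (shifted_prod (l @ l')) (x \<oplus> y) = \<zero>"
        using xy by (simp add: act_add_right)
      moreover have "set (l @ l') \<subseteq> {mu * r ^ Suc b | b. True}" using l(1) l'(1) by auto
      ultimately show ?case by blast
    next
      case (scal x c)
      then show ?case using F_span_carrier[OF _ S] by (auto simp: sc_out)
    next
      case (F x i)
      then obtain l where l: "set l \<subseteq> {mu * r ^ Suc b | b. True}" "act (shifted_prod l) x = \<zero>" by blast
      have x: "x \<in> carrier M" using F F_span_carrier[OF _ S] by auto
      show ?case
      proof (cases i)
        case I1
        then show ?thesis using l x by (intro exI[of _ l]) (simp add: shifted_prod_F1 q0)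
      next
        case I2
        have "set (map ((*) r) l) \<subseteq> {mu * r ^ Suc b | b. True}"
        proof
          fix c assume "c \<in> set (map ((*) r) l)"
          then obtain b where "c = r * (mu * r ^ Suc b)" using l(1) by auto
          then have "c = mu * r ^ Suc (Suc b)" by simp
          then show "c \<in> {mu * r ^ Suc b | b. True}" by blast
        qed
        then show ?thesis
          using I2 shifted_prod_F2[OF q0 x l(2)] unfolding r_def by blast
      qed
    qed
    assume "v \<in> F_span S"
    then obtain l where l: "set l \<subseteq> {mu * r ^ Suc b | b. True}" "act (shifted_prod l) v = \<zero>"
      using * by blast
    define a where "a = (\<Prod>c\<leftarrow>l. mu - c)"
    have "r ^ Suc b \<noteq> 1" for b
      using not_root[of "3 * Suc b"] unfolding r_def power_mult[symmetric]
      by (simp add: power_inverse del: power_Suc)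
    then have "mu - c \<noteq> 0" if "c \<in> set l" for c
      using that l(1) lam0 by (auto simp: mu_def)
    then have "a \<noteq> 0" by (auto simp: a_def prod_list_zero_iff)
    have "sc a v = \<zero>"
      using shifted_prod_eigen[OF v_carrier, of mu l] K12_w[of 0] l(2) by (simp add: w_simps a_def)
    then have "sc (inverse a) (sc a v) = \<zero>" by simp
    then show False using \<open>a \<noteq> 0\<close> v_nonzero by (simp add: sc_sc)
  qed
  ultimately have "F_span S = {\<zero>}"
    using simple v_carrier unfolding simple_module_def by metis
  moreover have "ac (GF I2) (w j) \<in> F_span S" by (auto simp: S_def intro: F_span.base)
  ultimately show ?thesis by blast
qed

end

context U_module
begin

lemma finsum_closed_under:
  assumes W: "W \<subseteq> carrier M" "\<zero> \<in> W" "\<And>x y. x \<in> W \<Longrightarrow> y \<in> W \<Longrightarrow> x \<oplus> y \<in> W"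
    and f: "\<And>b. b \<in> B \<Longrightarrow> f b \<in> W"
  shows "(\<Oplus>b\<in>B. f b) \<in> W"
  using f
proof (induction B rule: infinite_finite_induct)
  case (insert b B)
  then show ?case using W by (subst M.finsum_insert) auto
qed (use W in \<open>simp_all add: M.finsum_infinite\<close>)

lemma finite_dim_iff:
  "finite_dim q M \<longleftrightarrow> (\<exists>B. finite B \<and> B \<subseteq> carrier M \<and>
     (\<forall>x\<in>carrier M. \<exists>c. x = (\<Oplus>b\<in>B. sc (c b) b)))"
  by (simp add: finite_dim_def act_def)

end

section \<open>The map from \<open>V(\<lambda>)\<close> onto a simple highest weight module\<close>

locale simple_highest_weight = highest_weight +
  assumes simple: "simple_module (U q) M"
begin

definition lift :: "(nat \<Rightarrow>\<^sub>0 'a) \<Rightarrow> 'a falg" where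
  "lift = lin_ext (\<lambda>j. Poly_Mapping.single (replicate j (GF I1)) 1)"

text \<open>
  The linear map with \<open>u\<^sub>j \<mapsto> F\<^sub>1\<^bsup>j\<^esup>v\<close>, obtained by sending \<open>u\<^sub>j\<close> first to the word \<open>F\<^sub>1\<^bsup>j\<^esup>\<close> in the free algebra.
\<close>

definition psi :: "(nat \<Rightarrow>\<^sub>0 'a) \<Rightarrow> 'b" where "psi x = act (lift x) v"

lemma psi_carrier [simp]: "psi x \<in> carrier M"
  by (simp add: psi_def)

lemma psi_add: "psi (x + y) = psi x \<oplus> psi y"
  by (simp add: psi_def lift_def lin_ext_add act_add)

lemma psi_scale: "psi (scale c x) = sc c (psi x)"
  by (simp add: psi_def lift_def lin_ext_scale act_mult flip: scal_mult)

lemma psi_minus: "psi (x - y) = psi x \<ominus> psi y"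
  by (simp add: psi_def lift_def lin_ext_minus act_minus)

lemma psi_zero [simp]: "psi 0 = \<zero>"
  by (simp add: psi_def lift_def)

lemma psi_eq_iff: "psi x = psi y \<longleftrightarrow> psi (x - y) = \<zero>"
proof
  assume "psi (x - y) = \<zero>"
  then show "psi x = psi y" using psi_add[of "x - y" y] by simp
qed (simp add: psi_minus M.minus_eq M.r_neg)

lemma psi_basis: "psi (Poly_Mapping.single j 1) = w j"
proof (induction j)
  case 0
  have "(Poly_Mapping.single [] 1 :: 'a falg) = 1" by (simp flip: zero_list_def)
  then show ?case by (simp add: psi_def lift_def w_simps del: single_one)
next
  case (Suc j)
  have "Poly_Mapping.single (replicate (Suc j) (GF I1)) 1
      = FF I1 * Poly_Mapping.single (replicate j (GF I1)) (1 :: 'a)"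
    by (simp add: gen_elt_def mult_single plus_list_def)
  then show ?case using Suc by (simp add: psi_def lift_def w_simps act_mult)
qed

lemma psi_single: "psi (Poly_Mapping.single j c) = sc c (w j)"
  using psi_scale[of c "Poly_Mapping.single j 1"] by (simp add: psi_basis)

text \<open>
  Both sides have the same structure constants: those of \<open>V(\<lambda>)\<close> by definition, those of \<open>M\<close> by the
  computation of the orbit, with \<open>F\<^sub>2\<close> acting by zero thanks to simplicity.
\<close>

lemma psi_gen: "psi (V_gen q lam g x) = ac g (psi x)"
proof (induction x rule: poly_mapping_induct_single)
  case (single j c)
  have "psi (V_basis q lam g j) = ac g (w j)"
  proof (cases g)
    case (GE i)
    then show ?thesis
      by (cases i; cases j)
        (simp_all add: psi_single E1_w E2_w ecoef_def w_simps(1) E_v add.commute)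
  next
    case (GF i)
    then show ?thesis by (cases i) (simp_all add: psi_single w_simps F2_w_eq_zero[OF simple])
  next
    case (GK i)
    then show ?thesis by (cases i) (simp_all add: psi_single K_w wt_def cartan_def)
  next
    case (GKinv i)
    then show ?thesis by (cases i) (simp_all add: psi_single KI_w wt_def cartan_def)
  qed
  then show ?case by (simp add: psi_scale psi_single ac_sc)
qed (simp add: V_gen_add psi_add act_add_right)

lemma psi_V_free: "psi (V_free q lam p x) = act p (psi x)"
proof (induction p rule: poly_mapping_induct_single)
  case (single l c)
  have "psi (foldr (V_gen q lam) l x) = act (Poly_Mapping.single l 1) (psi x)"
  proof (induction l)
    case Nil
    have "(Poly_Mapping.single [] 1 :: 'a falg) = 1" by (simp flip: zero_list_def)
    then show ?case by (simp del: single_one)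
  next
    case (Cons g l)
    have "Poly_Mapping.single (g # l) 1 = gen_elt g * Poly_Mapping.single l (1 :: 'a)"
      by (simp add: gen_elt_def mult_single plus_list_def)
    then show ?case using Cons by (simp add: psi_gen act_mult)
  qed
  moreover have "Poly_Mapping.single l c = scal c * Poly_Mapping.single l 1"
    by (simp add: scal_def mult_single plus_list_def)
  ultimately show ?case by (simp add: V_free_single V_free_mult V_free_scal psi_scale act_mult)
qed (simp add: V_free_add psi_add act_add)

lemma range_psi: "range psi = carrier M"
proof -
  have "submodule (range psi) (U q) M"
  proof (rule submodule_criterion)
    show "\<zero> \<in> range psi" by (metis psi_zero rangeI)
  next
    fix x y assume "x \<in> range psi" "y \<in> range psi"
    then show "x \<oplus> y \<in> range psi" by (auto simp flip: psi_add)
  qed (auto simp flip: psi_scale psi_gen)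
  moreover have "v \<in> range psi" using psi_basis[of 0] by (metis rangeI w_simps(1))
  ultimately show ?thesis
    using simple v_nonzero unfolding simple_module_def by (metis singletonD)
qed

lemma lookup_V_gen_K1:
  "Poly_Mapping.lookup (V_gen q lam (GK I1) x) j = wt I1 j * Poly_Mapping.lookup x j"
  by (induction x rule: poly_mapping_induct_single)
     (simp_all add: V_gen_add lookup_add distrib_left lookup_single wt_def cartan_def when_def)

lemma wt_I1_inj: "wt I1 i = wt I1 j \<Longrightarrow> i = j"
proof -
  have "wt I1 k = lam I1 * inverse (q ^ (2 * k))" for k
  proof -
    have "q powi (- cartan I1 I1 * int k) = q powi (- int (2 * k))"
      by (simp add: cartan_def)
    then show ?thesis unfolding wt_def power_int_minus power_int_of_nat by simp
  qed
  then show "wt I1 i = wt I1 j \<Longrightarrow> i = j"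
    using lam0 qpow_inj[of "2 * i" "2 * j"] by auto
qed

text \<open>
  The kernel is stable under \<open>K\<^sub>1\<close>, whose eigenvalues on the basis vectors \<open>u\<^sub>j\<close> are distinct. So a basis
  vector \<open>u\<^sub>k\<close> occurring in an element of the kernel can be removed by applying \<open>K\<^sub>1\<close> minus its
  eigenvalue, until only \<open>u\<^sub>j\<close> is left.
\<close>

lemma psi_kernel_graded: "psi x = \<zero> \<Longrightarrow> j \<in> Poly_Mapping.keys x \<Longrightarrow> w j = \<zero>"
proof (induction "card (Poly_Mapping.keys x)" arbitrary: x rule: less_induct)
  case less
  show ?case
  proof (cases "Poly_Mapping.keys x = {j}")
    case True
    let ?c = "Poly_Mapping.lookup x j"
    have "x = Poly_Mapping.single j ?c"
      using True by (intro poly_mapping_eqI) (auto simp: lookup_single when_def in_keys_iff)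
    then have "sc ?c (w j) = \<zero>" using less.prems(1) psi_single by metis
    then have "sc (inverse ?c) (sc ?c (w j)) = \<zero>" by simp
    then show ?thesis using less.prems(2) by (simp add: sc_sc in_keys_iff)
  next
    case False
    then obtain k where k: "k \<in> Poly_Mapping.keys x" "k \<noteq> j" using less.prems(2) by blast
    define y where "y = V_gen q lam (GK I1) x - scale (wt I1 k) x"
    have lookup: "Poly_Mapping.lookup y i = (wt I1 i - wt I1 k) * Poly_Mapping.lookup x i" for i
      by (simp add: y_def lookup_minus lookup_V_gen_K1 left_diff_distrib)
    have keys: "Poly_Mapping.keys y = Poly_Mapping.keys x - {k}"
      using wt_I1_inj by (auto simp: in_keys_iff lookup)
    have "psi y = \<zero>"
      using less.prems(1) by (simp add: y_def psi_minus psi_gen psi_scale M.minus_eq)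
    moreover have "card (Poly_Mapping.keys y) < card (Poly_Mapping.keys x)"
      unfolding keys using k(1) by (intro psubset_card_mono) auto
    ultimately show ?thesis using less.hyps[of y] less.prems(2) k keys by auto
  qed
qed

lemma psi_kernel: "psi x = \<zero> \<longleftrightarrow> (\<forall>j\<in>Poly_Mapping.keys x. w j = \<zero>)"
proof
  assume w: "\<forall>j\<in>Poly_Mapping.keys x. w j = \<zero>"
  show "psi x = \<zero>"
    by (rule poly_mapping_keys_induct) (use w in \<open>simp_all add: psi_add psi_single\<close>)
qed (use psi_kernel_graded in blast)

text \<open>
  If the orbit vanishes at some point, let \<open>m + 1\<close> be the first exponent where it does. Then
  \<open>0 = E\<^sub>1F\<^sub>1\<^bsup>m+1\<^esup>v = [m+1]\<^sub>q[\<lambda>\<^sub>1;-m]\<^sub>q F\<^sub>1\<^bsup>m\<^esup>v\<close> forces \<open>[\<lambda>\<^sub>1;-m]\<^sub>q = 0\<close>, that is, \<open>\<lambda>\<^sub>1\<^sup>2 = q\<^bsup>2m\<^esup>\<close>.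
\<close>

lemma w_dichotomy:
  obtains (inf) "\<And>j. w j \<noteq> \<zero>"
  | (fin) m where "L_defined q lam m" "\<And>j. w j = \<zero> \<longleftrightarrow> m < j"
proof (cases "\<exists>j. w j = \<zero>")
  case True
  define n where "n = (LEAST j. w j = \<zero>)"
  have n: "w n = \<zero>" and least: "\<And>j. j < n \<Longrightarrow> w j \<noteq> \<zero>"
    unfolding n_def using True by (auto intro: LeastI_ex dest: not_less_Least)
  have "n \<noteq> 0" using n v_nonzero w_simps(1) by metis
  then obtain m where m: "n = Suc m" by (cases n) auto
  have up: "w (n + k) = \<zero>" for k
    by (induction k) (simp_all add: n w_simps)
  have "w j = \<zero> \<longleftrightarrow> m < j" for j
    using up[of "j - n"] least[of j] m by (cases "j < n") auto
  moreover have "L_defined q lam m"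
  proof -
    have "sc (ecoef n) (w m) = \<zero>" using E1_w[of m] n m by simp
    then have "sc (inverse (ecoef n)) (sc (ecoef n) (w m)) = \<zero>" by simp
    then have e: "ecoef n = 0" using least[of m] m by (cases "ecoef n = 0") (simp_all add: sc_sc)
    have "qint q (int n) \<noteq> 0"
    proof
      assume "qint q (int n) = 0"
      then have "q ^ n = inverse (q ^ n)"
        using qq q0 by (auto simp: qint_def power_int_minus field_simps)
      then have "q ^ (n + n) = q ^ 0" using q0 by (simp add: power_add field_simps)
      from qpow_inj[OF this] show False using m by simp
    qed
    then have "qbracket q (lam I1) (1 - int n) = 0" using e by (simp add: ecoef_def)
    moreover have "1 - int n = - int m" "q - inverse q \<noteq> 0"
      using m qq q0 by (auto simp: field_simps)
    ultimately have "lam I1 * inverse (q ^ m) = inverse (lam I1) * q ^ m"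
      by (simp add: qbracket_def power_int_minus)
    then have "lam I1 * lam I1 = q ^ m * q ^ m"
      using q0 lam0[of I1] by (simp add: field_simps)
    then show ?thesis by (simp add: L_defined_def square_eq_iff)
  qed
  ultimately show ?thesis using fin by blast
qed (use inf in blast)

section \<open>The two cases\<close>

lemma V_smult': "cls q p \<odot>\<^bsub>V q lam\<^esub> x = V_free q lam p x"
  using V_smult[OF q0 qq] lam0 by blast

lemma isomorphic_V:
  assumes "\<And>j. w j \<noteq> \<zero>"
  shows "modules_isomorphic (U q) M (V q lam)"
proof -
  have inj: "inj psi"
  proof (rule injI)
    fix x y assume "psi x = psi y"
    then have "psi (x - y) = \<zero>" by (simp add: psi_minus M.minus_eq M.r_neg)
    then have "Poly_Mapping.keys (x - y) = {}" using assms by (auto simp: psi_kernel)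
    then show "x = y" by (metis keys_eq_empty right_minus_eq)
  qed
  have bij: "bij_betw (inv_into UNIV psi) (carrier M) UNIV"
    using bij_betw_inv_into[of psi UNIV "carrier M"] inj range_psi by (simp add: bij_betw_def)
  have inv: "inv_into UNIV psi (psi x) = x" for x using inj by simp
  have "inv_into UNIV psi \<in> iso (add_monoid M) (add_monoid (V q lam))"
  proof (rule isoI)
    show "inv_into UNIV psi \<in> hom (add_monoid M) (add_monoid (V q lam))"
      by (rule homI) (auto simp: V_def inv simp flip: range_psi psi_add)
  qed (use bij in \<open>simp add: V_def\<close>)
  moreover have "inv_into UNIV psi (a \<odot> x) = a \<odot>\<^bsub>V q lam\<^esub> inv_into UNIV psi x" if "a \<in> carrier (U q)" "x \<in> carrier M" for a x
    using that by (auto simp: carrier_U V_smult' inv psi_V_free[symmetric] act_def[symmetric] simp flip: range_psi)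
  ultimately show ?thesis by (auto simp: modules_isomorphic_def module_iso_def)
qed

text \<open>
  In this case the kernel of \<open>psi\<close> is \<open>J'(\<lambda>)\<close>. Its cosets are the fibres of \<open>psi\<close>, so the isomorphism takes an
  element of \<open>M\<close> to the fibre over it.
\<close>

lemma isomorphic_L:
  assumes w: "\<And>j. w j = \<zero> \<longleftrightarrow> m < j"
  shows "modules_isomorphic (U q) M (L q lam m)"
proof -
  define f where "f x = psi -` {x}" for x
  have ker: "x \<in> J' m \<longleftrightarrow> psi x = \<zero>" for x
    by (auto simp: J'_def psi_kernel w)
  have coset: "J' m +>\<^bsub>V q lam\<^esub> y = f (psi y)" for y
  proof -
    have "x \<in> J' m +>\<^bsub>V q lam\<^esub> y \<longleftrightarrow> x - y \<in> J' m" for x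
      by (force simp: a_r_coset_def r_coset_def V_def)
    then show ?thesis
      by (simp add: set_eq_iff f_def ker psi_eq_iff)
  qed
  have "f (psi x) = f (psi y) \<Longrightarrow> psi x = psi y" for x y
    unfolding f_def by auto
  then have inj: "inj_on f (carrier M)"
    by (auto intro!: inj_onI simp flip: range_psi)
  have carrier_L: "carrier (L q lam m) = f ` carrier M"
  proof -
    have "carrier (L q lam m) = (\<Union>y\<in>carrier (V q lam). {J' m +>\<^bsub>V q lam\<^esub> y})"
      unfolding L_def quotient_module_def by (simp add: A_RCOSETS_defs a_r_coset_def)
    also have "carrier (V q lam) = UNIV" by (simp add: V_def)
    finally show ?thesis by (auto simp: coset simp flip: range_psi)
  qed
  have add: "f (psi x \<oplus> psi y) = f (psi x) \<oplus>\<^bsub>L q lam m\<^esub> f (psi y)" for x y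
  proof -
    have "f (psi x) \<oplus>\<^bsub>L q lam m\<^esub> f (psi y) = (\<Union>a\<in>f (psi x). \<Union>b\<in>f (psi y). {a + b})"
      by (simp add: L_def quotient_module_def set_add_def set_mult_def V_def)
    also have "\<dots> = f (psi (x + y))"
    proof (intro equalityI subsetI)
      fix z assume "z \<in> f (psi (x + y))"
      then have "psi (z - y) = psi x"
        by (simp add: f_def psi_minus psi_add M.minus_eq M.a_assoc M.r_neg)
      then have "z - y \<in> f (psi x)" "y \<in> f (psi y)" by (simp_all add: f_def)
      then show "z \<in> (\<Union>a\<in>f (psi x). \<Union>b\<in>f (psi y). {a + b})"
        by (intro UN_I[of "z - y"] UN_I[of y]) simp_all
    qed (auto simp: f_def psi_add)
    finally show ?thesis by (simp add: psi_add)
  qed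
  have smult: "f (act p (psi x)) = cls q p \<odot>\<^bsub>L q lam m\<^esub> f (psi x)" for p x
  proof -
    have "cls q p \<odot>\<^bsub>L q lam m\<^esub> f (psi x) = (\<Union>y\<in>f (psi x). f (act p (psi y)))"
      by (simp add: L_def quotient_module_def V_smult' coset psi_V_free)
    also have "\<dots> = (\<Union>y\<in>f (psi x). f (act p (psi x)))"
      by (rule SUP_cong) (simp_all add: f_def)
    also have "\<dots> = f (act p (psi x))"
      by (auto simp: f_def)
    finally show ?thesis by simp
  qed
  have "f \<in> iso (add_monoid M) (add_monoid (L q lam m))"
  proof (rule isoI)
    show "f \<in> hom (add_monoid M) (add_monoid (L q lam m))"
      by (rule homI) (auto simp: carrier_L add simp flip: range_psi)
  qed (use inj in \<open>simp add: carrier_L bij_betw_def\<close>)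
  moreover have "f (a \<odot> x) = a \<odot>\<^bsub>L q lam m\<^esub> f x" if a: "a \<in> carrier (U q)" and x: "x \<in> carrier M" for a x
  proof -
    obtain p where p: "a = cls q p" using a by (auto simp: carrier_U)
    obtain y where y: "x = psi y" using x by (auto simp flip: range_psi)
    show ?thesis using smult[of p y] unfolding p y by (simp add: act_def)
  qed
  ultimately show ?thesis by (auto simp: modules_isomorphic_def module_iso_def)
qed

text \<open>
  Finitely many vectors involve finitely many \<open>F\<^sub>1\<^bsup>j\<^esup>v\<close>, so their span misses any other \<open>F\<^sub>1\<^bsup>n\<^esup>v\<close>: the orbit is
  linearly independent, because the kernel of \<open>psi\<close> is graded.
\<close>

lemma not_finite_dim_if_orbit_nonzero:
  assumes "\<And>j. w j \<noteq> \<zero>"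
  shows "\<not> finite_dim q M"
proof
  assume "finite_dim q M"
  then obtain B where B: "finite B" "B \<subseteq> carrier M"
    and span: "\<And>x. x \<in> carrier M \<Longrightarrow> \<exists>c. x = (\<Oplus>b\<in>B. sc (c b) b)"
    unfolding finite_dim_iff by blast
  have "\<exists>y. b = psi y" if "b \<in> B" for b
    using that B(2) by (auto simp flip: range_psi)
  then obtain y where y: "\<And>b. b \<in> B \<Longrightarrow> b = psi (y b)" by metis
  obtain n where n: "n \<notin> (\<Union>b\<in>B. Poly_Mapping.keys (y b))"
    using B(1) by (meson ex_new_if_finite finite_UN_I finite_keys infinite_UNIV_nat)
  define W where "W = psi ` {x. Poly_Mapping.lookup x n = 0}"
  obtain c where c: "w n = (\<Oplus>b\<in>B. sc (c b) b)" using span[of "w n"] by auto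
  have "(\<Oplus>b\<in>B. sc (c b) b) \<in> W"
  proof (rule finsum_closed_under)
    show "\<zero> \<in> W" by (auto simp: W_def intro!: image_eqI[of _ _ 0])
    show "x \<oplus> z \<in> W" if "x \<in> W" "z \<in> W" for x z
      using that by (auto simp: W_def lookup_add simp flip: psi_add)
    show "sc (c b) b \<in> W" if "b \<in> B" for b
    proof -
      have "sc (c b) b = psi (scale (c b) (y b))" using y[OF that] by (simp add: psi_scale)
      moreover have "Poly_Mapping.lookup (y b) n = 0" using n that by (auto simp: in_keys_iff)
      ultimately show ?thesis by (auto simp: W_def)
    qed
  qed (auto simp: W_def)
  then obtain x where x: "Poly_Mapping.lookup x n = 0" "w n = psi x"
    unfolding c[symmetric] by (auto simp: W_def)
  then have "psi (Poly_Mapping.single n 1 - x) = \<zero>"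
    by (simp add: psi_minus psi_basis M.minus_eq M.r_neg)
  moreover have "n \<in> Poly_Mapping.keys (Poly_Mapping.single n 1 - x)"
    using x(1) by (simp add: in_keys_iff lookup_minus)
  ultimately show False using psi_kernel_graded assms by blast
qed

lemma finite_dim_if_orbit_vanishes:
  assumes w: "\<And>j. w j = \<zero> \<longleftrightarrow> m < j"
  shows "finite_dim q M"
  unfolding finite_dim_iff
proof (intro exI[of _ "w ` {..m}"] conjI ballI)
  show "finite (w ` {..m})" "w ` {..m} \<subseteq> carrier M" by auto
  fix x assume "x \<in> carrier M"
  then obtain y where y: "x = psi y" by (auto simp flip: range_psi)
  have inj: "inj_on w {..m}"
  proof (rule inj_onI, rule ccontr)
    fix i j assume ij: "i \<in> {..m}" "j \<in> {..m}" "w i = w j" "i \<noteq> j"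
    then have "psi (Poly_Mapping.single i 1 - Poly_Mapping.single j 1) = \<zero>"
      by (simp add: psi_minus psi_basis M.minus_eq M.r_neg)
    moreover have "i \<in> Poly_Mapping.keys (Poly_Mapping.single i (1::'a) - Poly_Mapping.single j 1)"
      using ij(4) by (simp add: in_keys_iff lookup_minus lookup_single)
    ultimately show False using psi_kernel_graded w[of i] ij(1) by auto
  qed
  have psi_sum: "psi (\<Sum>j\<in>S. Poly_Mapping.single j (c j)) = (\<Oplus>j\<in>S. sc (c j) (w j))"
    if "finite S" for S c
    using that by (induction S) (simp_all add: psi_add psi_single)
  let ?y = "\<Sum>j\<le>m. Poly_Mapping.single j (Poly_Mapping.lookup y j)"
  have "psi (y - ?y) = \<zero>"
    unfolding psi_kernel
  proof
    fix j assume "j \<in> Poly_Mapping.keys (y - ?y)"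
    then show "w j = \<zero>"
      by (cases "j \<le> m")
         (auto simp: w in_keys_iff lookup_minus lookup_sum lookup_single when_def)
  qed
  moreover have "x = psi (y - ?y) \<oplus> psi ?y" by (simp add: y flip: psi_add)
  ultimately have "x = (\<Oplus>j\<in>{..m}. sc (Poly_Mapping.lookup y j) (w j))"
    by (simp add: psi_sum)
  also have "\<dots> = (\<Oplus>j\<in>{..m}. sc (Poly_Mapping.lookup y (the_inv_into {..m} w (w j))) (w j))"
    using inj by (intro M.finsum_cong') (auto simp: the_inv_into_f_f)
  also have "\<dots> = (\<Oplus>b\<in>w ` {..m}. sc (Poly_Mapping.lookup y (the_inv_into {..m} w b)) b)"
    using inj by (subst M.finsum_reindex) auto
  finally show "\<exists>c. x = (\<Oplus>b\<in>w ` {..m}. sc (c b) b)" by - (rule exI, assumption)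
qed

end

theorem proposition2p13:
  fixes q :: "'k :: {alg_closed_field, field_char_0}"
    and lam :: "idx \<Rightarrow> 'k"
    and M :: "('k falg set, 'm) module"
  assumes "q \<noteq> 0" and "q \<noteq> 1" and "q \<noteq> -1"
    and not_root_of_unity: "\<forall>n::nat. n > 0 \<longrightarrow> q ^ n \<noteq> 1"
    and "\<forall>i. lam i \<noteq> 0"
    and "highest_weight_module q M lam"
    and "simple_module (U q) M"
  shows "(finite_dim q M \<longrightarrow>
            (\<exists>m. L_defined q lam m \<and> modules_isomorphic (U q) M (L q lam m))) \<and>
         (\<not> finite_dim q M \<longrightarrow> modules_isomorphic (U q) M (V q lam))"
proof -
  obtain v where "highest_weight_vector q M lam v" and "left_module (U q) M"
    using assms(6) unfolding highest_weight_module_def by blast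
  then interpret simple_highest_weight q M lam v
    using assms by (simp add: simple_highest_weight_def U_module_def highest_weight_def
        highest_weight_axioms_def simple_highest_weight_axioms_def)
  show ?thesis
  proof (cases rule: w_dichotomy)
    case inf
    then show ?thesis using isomorphic_V not_finite_dim_if_orbit_nonzero by blast
  next
    case (fin m)
    then show ?thesis using isomorphic_L[of m] finite_dim_if_orbit_vanishes[of m] by blast
  qed
qed

end
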